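(* Let $\mathcal D,\mathcal D'$ be distributions on $\mathcal W\times\mathcal V$ with $\mathcal D'\ll_{\kappa,\mathrm{comb}}\mathcal D$, witnessed by factor distributions $\mathcal D_{\mathcal W,i}$, $\mathcal D_{\mathcal V,j}$ ($i,j\in\{1,2\}$). Let $h_\star=\langle f_\star,g_\star\rangle$ and $\hat h=\langle\hat f,\hat g\rangle$ with $f_\star,\hat f:\mathcal W\to\mathbb R^p$, $g_\star,\hat g:\mathcal V\to\mathbb R^p$ (all relevant expectations finite). Define $$\sigma_\star^2:=\sigma_p\big(\mathbb E_{w\sim\mathcal D_{\mathcal W,1}}[f_\star(w)f_\star(w)^\top]\big)\,\sigma_p\big(\mathbb E_{v\sim\mathcal D_{\mathcal V,1}}[g_\star(v)g_\star(v)^\top]\big),$$ assume $\sigma_\star>0$ and $\max_{1\le i,j\le2}\mathbb E_{\mathcal D_{i\otimes j}}|h_\star(w,v)|^2\le M_\star^2$. If $\mathcal R(\hat h;\mathcal D)\le\frac{\sigma_\star^2}{4\kappa}$, then $$\mathcal R(\hat h;\mathcal D')\le\mathcal R(\hat h;\mathcal D)\cdot\kappa^2\Big(1+64\frac{M_\star^4}{\sigma_\star^4}\Big).$$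
   Context: For nonnegative measures $\mu_1,\mu_2$ on a common space, $\mu_1\ll_\kappa\mu_2$ means $\mu_1(A)\le\kappa\mu_2(A)$ for every measurable $A$. For distributions $\mathcal D,\mathcal D'$ on a product space $\mathcal W\times\mathcal V$, $\mathcal D'\ll_{\kappa,\mathrm{comb}}\mathcal D$ (bounded combinatorial density ratio) means there exist distributions $\mathcal D_{\mathcal W,i}$ on $\mathcal W$ and $\mathcal D_{\mathcal V,j}$ on $\mathcal V$, $i,j\in\{1,2\}$, such that with $\mathcal D_{i\otimes j}:=\mathcal D_{\mathcal W,i}\otimes\mathcal D_{\mathcal V,j}$: $\sum_{(i,j)\ne(2,2)}\mathcal D_{i\otimes j}\ll_\kappa\mathcal D$ and $\mathcal D'\ll_\kappa\sum_{i,j\in\{1,2\}}\mathcal D_{i\otimes j}$. The risk of a scalar predictor is $\mathcal R(\hat h;\mathcal D):=\mathbb E_{(w,v)\sim\mathcal D}[(h_\star(w,v)-\hat h(w,v))^2]$. $\sigma_p$ denotes the $p$-th largest singular value. *)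

theory Defs
  imports "HOL-Probability.Probability" "Jordan_Normal_Form.Char_Poly"
begin

definition singular_values :: "real mat \<Rightarrow> real list" where
  "singular_values A =
     rev (sorted_list_of_multiset (image_mset sqrt (proots (char_poly (transpose_mat A * A)))))"

text \<open>sigma_k A is the k-th largest singular value (k counted from 1).\<close>
definition sigma :: "nat \<Rightarrow> real mat \<Rightarrow> real" where
  "sigma k A = singular_values A ! (k - 1)"

text \<open>Vectors in R^p are represented as functions nat => real, only indices < p matter.\<close>
definition inner_p :: "nat \<Rightarrow> (nat \<Rightarrow> real) \<Rightarrow> (nat \<Rightarrow> real) \<Rightarrow> real" where
  "inner_p p x y = (\<Sum>i<p. x i * y i)"

definition second_moment :: "nat \<Rightarrow> 'a measure \<Rightarrow> ('a \<Rightarrow> nat \<Rightarrow> real) \<Rightarrow> real mat" where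
  "second_moment p M f = mat p p (\<lambda>(i, k). \<integral>w. f w i * f w k \<partial>M)"

definition dens_le :: "real \<Rightarrow> 'a measure \<Rightarrow> 'a measure \<Rightarrow> bool" where
  "dens_le \<kappa> \<mu>1 \<mu>2 \<longleftrightarrow> (\<forall>A\<in>sets \<mu>2. measure \<mu>1 A \<le> \<kappa> * measure \<mu>2 A)"

text \<open>Bounded combinatorial density ratio D' <<_{kappa,comb} D, witnessed by the
  factor distributions DW1, DW2 (on W) and DV1, DV2 (on V). Sums of measures are
  evaluated setwise.\<close>
definition comb_dens_le ::
  "real \<Rightarrow> ('w \<times> 'v) measure \<Rightarrow> ('w \<times> 'v) measure \<Rightarrow>
   'w measure \<Rightarrow> 'w measure \<Rightarrow> 'v measure \<Rightarrow> 'v measure \<Rightarrow> bool" where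
  "comb_dens_le \<kappa> D' D DW1 DW2 DV1 DV2 \<longleftrightarrow>
     prob_space DW1 \<and> prob_space DW2 \<and> prob_space DV1 \<and> prob_space DV2 \<and>
     sets DW2 = sets DW1 \<and> sets DV2 = sets DV1 \<and>
     (\<forall>A\<in>sets D.
        measure (DW1 \<Otimes>\<^sub>M DV1) A + measure (DW1 \<Otimes>\<^sub>M DV2) A + measure (DW2 \<Otimes>\<^sub>M DV1) A
          \<le> \<kappa> * measure D A) \<and>
     (\<forall>A\<in>sets D'.
        measure D' A \<le> \<kappa> * (measure (DW1 \<Otimes>\<^sub>M DV1) A + measure (DW1 \<Otimes>\<^sub>M DV2) A
                             + measure (DW2 \<Otimes>\<^sub>M DV1) A + measure (DW2 \<Otimes>\<^sub>M DV2) A))"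

definition risk :: "('a \<Rightarrow> real) \<Rightarrow> ('a \<Rightarrow> real) \<Rightarrow> 'a measure \<Rightarrow> real" where
  "risk hstar hhat D = (\<integral>x. (hstar x - hhat x)\<^sup>2 \<partial>D)"

end

theory Submission
  imports Defs
begin

text \<open>
  View \<open>h\<^sub>\<star>\<close> and its estimate \<open>h'\<close>, restricted to the four product distributions, as \<open>2 \<times> 2\<close> block operators
  \<open>A\<close> and \<open>B\<close> of rank at most \<open>p\<close>, and let \<open>\<Delta> = A - B\<close>. If \<open>L\<close> satisfies \<open>L A\<^sub>1\<^sub>j = A\<^sub>2\<^sub>j\<close> and \<open>R\<close>
  satisfies \<open>B\<^sub>i\<^sub>1 R = B\<^sub>i\<^sub>2\<close>, then
  \<open>\<Delta>\<^sub>2\<^sub>2 = \<Delta>\<^sub>2\<^sub>1 R + L \<Delta>\<^sub>1\<^sub>2 - L \<Delta>\<^sub>1\<^sub>1 R\<close>,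
  so the error on the unseen block is controlled by the errors on the three seen ones.
  The least singular value of \<open>A\<^sub>1\<^sub>1\<close> is at least \<open>\<sigma>\<^sub>\<star>\<close>, and \<open>\<parallel>\<Delta>\<^sub>1\<^sub>1\<parallel> \<le> \<sigma>\<^sub>\<star> / 2\<close>; hence \<open>L\<close> and \<open>R\<close>
  exist with Hilbert-Schmidt norms at most \<open>M\<^sub>\<star> / \<sigma>\<^sub>\<star>\<close> and \<open>3 M\<^sub>\<star> / \<sigma>\<^sub>\<star>\<close>. Taking the kernel of \<open>R\<close>
  in the span of \<open>g\<^sub>\<star>\<close> rather than of its estimate avoids any perturbation theory for singular values.
\<close>

unbundle no inner_syntax and no vec_syntax

section \<open>The least singular value of a positive semidefinite matrix\<close>

text \<open>Source of both Cauchy-Schwarz inequalities below, for semidefinite matrices and for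
  integrals. Both forms can be degenerate, so \<open>a = 0\<close> is allowed; the quadratic is then
  affine in \<open>t\<close> and bounded below only if \<open>b = 0\<close>.\<close>

lemma quadratic_nonneg_discriminant:
  fixes a b c :: real
  assumes "\<And>t. 0 \<le> c + 2 * t * b + t\<^sup>2 * a" and "a \<ge> 0"
  shows "b\<^sup>2 \<le> c * a"
proof (cases "a = 0")
  case True
  have "b = 0"
  proof (rule ccontr)
    assume "b \<noteq> 0"
    \<comment> \<open>At this \<open>t\<close> the affine function takes the value -1.\<close>
    with assms(1)[of "- (c + 1) / (2 * b)"] True show False by (simp add: field_simps)
  qed
  then show ?thesis using True by simp
next
  case False
  then have "a > 0" using assms(2) by simp
  have "0 \<le> c - b\<^sup>2 / a" using assms(1)[of "- b / a"] False
    by (simp add: field_simps power2_eq_square)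
  then show ?thesis using \<open>a > 0\<close> by (simp add: field_simps)
qed

section \<open>Real spectrum of symmetric matrices\<close>

text \<open>By induction, splitting off one linear factor per root supplied by the fundamental
  theorem of algebra. The count with multiplicity ensures that the index used by
  \<open>sigma\<close> stays inside the list of singular values.\<close>

lemma size_proots_eq_degree_real:
  fixes q :: "real poly"
  assumes "\<And>z::complex. poly (map_poly of_real q) z = 0 \<Longrightarrow> z \<in> \<real>"
  shows "size (proots q) = degree q"
  using assms
proof (induction "degree q" arbitrary: q)
  case 0
  then show ?case using size_proots_le[of q] by simp
next
  case (Suc n)
  have "degree (map_poly complex_of_real q) = degree q" by (simp add: degree_map_poly)
  hence "\<not> constant (poly (map_poly complex_of_real q))"
    using Suc(2) by (simp add: constant_degree)
  then obtain z where z: "poly (map_poly complex_of_real q) z = 0"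
    using fundamental_theorem_of_algebra by blast
  then obtain a where a: "z = of_real a" using Suc(3) Reals_cases by blast
  have "complex_of_real (poly q a) = 0" using z a by simp
  hence "poly q a = 0" by simp
  then obtain r where r: "q = [:-a, 1:] * r" using poly_eq_0_iff_dvd by blast
  have r0: "r \<noteq> 0" using r Suc(2) by auto
  have deg: "degree q = Suc (degree r)" unfolding r using r0 by (subst degree_mult_eq) auto
  have hom: "map_poly complex_of_real q = map_poly of_real [:-a, 1:] * map_poly of_real r"
    unfolding r by (rule poly_eqI) (simp add: coeff_map_poly coeff_pCons split: nat.split)
  have "size (proots r) = degree r"
    using Suc(1)[of r] Suc(2,3) deg hom by auto
  moreover have "proots q = proots [:-a, 1:] + proots r"
    unfolding r using r0 by (intro proots_mult) auto
  ultimately show ?case using deg by simp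
qed

text \<open>For an eigenvector \<open>v\<close>, the Hermitian form \<open>Q\<close> is invariant
  under conjugation and equals \<open>z\<close> times the squared norm \<open>N > 0\<close>; hence
  \<open>z\<close> is a quotient of reals.\<close>

lemma char_poly_symmetric_real_roots:
  fixes B :: "real mat"
  assumes B: "B \<in> carrier_mat n n" and sym: "transpose_mat B = B"
    and root: "poly (map_poly complex_of_real (char_poly B)) z = 0"
  shows "z \<in> \<real>"
proof -
  let ?B = "map_mat complex_of_real B"
  have cB: "?B \<in> carrier_mat n n" using B by simp
  have "poly (char_poly ?B) z = 0" using root of_real_hom.char_poly_hom[OF B] by metis
  hence "eigenvalue ?B z" using eigenvalue_root_char_poly[OF cB] by simp
  then obtain v where v: "v \<in> carrier_vec n" "v \<noteq> 0\<^sub>v n" "?B *\<^sub>v v = z \<cdot>\<^sub>v v"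
    unfolding eigenvalue_def eigenvector_def using B by auto
  have row: "(\<Sum>j<n. of_real (B $$ (i,j)) * v $ j) = z * v $ i" if "i < n" for i
  proof -
    have "(?B *\<^sub>v v) $ i = (z \<cdot>\<^sub>v v) $ i" using v by simp
    thus ?thesis using that B v(1) by (simp add: scalar_prod_def lessThan_atLeast0)
  qed
  have symB: "B $$ (i,j) = B $$ (j,i)" if "i < n" "j < n" for i j
    using sym B that by (metis carrier_matD index_transpose_mat(1))
  define Q where "Q = (\<Sum>i<n. \<Sum>j<n. cnj (v $ i) * of_real (B $$ (i,j)) * v $ j)"
  define N where "N = (\<Sum>i<n. (cmod (v $ i))\<^sup>2)"
  have "cnj Q = (\<Sum>i<n. \<Sum>j<n. cnj (v $ j) * of_real (B $$ (i,j)) * v $ i)"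
    unfolding Q_def by (simp add: mult_ac)
  also have "\<dots> = (\<Sum>j<n. \<Sum>i<n. cnj (v $ j) * of_real (B $$ (i,j)) * v $ i)"
    by (rule sum.swap)
  also have "\<dots> = Q" unfolding Q_def using symB by (intro sum.cong refl) auto
  finally have Qr: "Q \<in> \<real>" by (simp add: Reals_cnj_iff)
  have "Q = (\<Sum>i<n. cnj (v $ i) * (\<Sum>j<n. of_real (B $$ (i,j)) * v $ j))"
    unfolding Q_def by (simp add: sum_distrib_left mult.assoc)
  also have "\<dots> = (\<Sum>i<n. z * of_real ((cmod (v $ i))\<^sup>2))"
    using row by (intro sum.cong refl) (simp add: complex_norm_square[symmetric] mult_ac)
  also have "\<dots> = z * of_real N" unfolding N_def by (simp add: sum_distrib_left)
  finally have QN: "Q = z * of_real N" .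
  obtain k where k: "k < n" "v $ k \<noteq> 0" using v(1,2) by (metis eq_vecI carrier_vecD index_zero_vec)
  have "N > 0" unfolding N_def using k by (intro sum_pos2[of _ k]) auto
  hence "z = Q / of_real N" using QN by simp
  thus ?thesis using Qr by simp
qed

section \<open>Lower bounds for positive semidefinite forms\<close>

text \<open>The form at \<open>y + t x\<close> is a nonnegative quadratic in \<open>t\<close>; by
  symmetry its linear coefficient is twice the mixed term.\<close>

lemma psd_Cauchy_Schwarz:
  fixes B :: "real mat"
  assumes B: "B \<in> carrier_mat n n" and sym: "transpose_mat B = B"
    and psd: "\<And>x. x \<in> carrier_vec n \<Longrightarrow> 0 \<le> x \<bullet> (B *\<^sub>v x)"
    and x: "x \<in> carrier_vec n" and y: "y \<in> carrier_vec n"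
  shows "(y \<bullet> (B *\<^sub>v x))\<^sup>2 \<le> (y \<bullet> (B *\<^sub>v y)) * (x \<bullet> (B *\<^sub>v x))"
proof -
  define a b c where "a = x \<bullet> (B *\<^sub>v x)" and "b = y \<bullet> (B *\<^sub>v x)" and "c = y \<bullet> (B *\<^sub>v y)"
  have b': "x \<bullet> (B *\<^sub>v y) = b"
    unfolding b_def using transpose_vec_mult_scalar[OF B x y] sym B x y
    by (metis comm_scalar_prod mult_mat_vec_carrier)
  have quad: "0 \<le> c + 2 * t * b + t\<^sup>2 * a" for t
  proof -
    have "(y + t \<cdot>\<^sub>v x) \<bullet> (B *\<^sub>v (y + t \<cdot>\<^sub>v x)) = c + 2 * t * b + t\<^sup>2 * a"
      using x y B b' unfolding a_def b_def c_def
      by (simp add: mult_add_distrib_mat_vec[of _ n n] mult_mat_vec[of _ n n]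
          scalar_prod_add_distrib[of _ n] add_scalar_prod_distrib[of _ n]
          power2_eq_square algebra_simps)
    thus ?thesis using psd[of "y + t \<cdot>\<^sub>v x"] x y by auto
  qed
  have a0: "a \<ge> 0" using psd[OF x] a_def by simp
  show ?thesis
    using quadratic_nonneg_discriminant[OF quad a0] unfolding a_def b_def c_def .
qed

lemma quadratic_form_bounded:
  fixes C :: "real mat"
  assumes C: "C \<in> carrier_mat n n"
  obtains K where "K > 0" "\<And>x. x \<in> carrier_vec n \<Longrightarrow> x \<bullet> (C *\<^sub>v x) \<le> K * (x \<bullet> x)"
proof
  define K where "K = (\<Sum>i<n. \<Sum>j<n. \<bar>C $$ (i,j)\<bar>)"
  \<comment> \<open>The extra 1 keeps the constant positive even for the zero matrix, so that it can
    be inverted later.\<close>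
  show "K + 1 > 0" unfolding K_def by (smt (verit) sum_nonneg abs_ge_zero)
  fix x :: "real vec" assume x: "x \<in> carrier_vec n"
  have xx: "x \<bullet> x = (\<Sum>i<n. (x $ i)\<^sup>2)"
    using x by (simp add: scalar_prod_def lessThan_atLeast0 power2_eq_square)
  have le: "(x $ i)\<^sup>2 \<le> x \<bullet> x" if "i < n" for i
    unfolding xx using that by (intro member_le_sum) auto
  have "x \<bullet> (C *\<^sub>v x) = (\<Sum>i<n. \<Sum>j<n. C $$ (i,j) * (x $ i * x $ j))"
    using x C by (simp add: scalar_prod_def lessThan_atLeast0 sum_distrib_left mult_ac)
  also have "\<dots> \<le> (\<Sum>i<n. \<Sum>j<n. \<bar>C $$ (i,j)\<bar> * (x \<bullet> x))"
  proof (intro sum_mono)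
    fix i j assume "i \<in> {..<n}" "j \<in> {..<n}"
    hence "(x $ i)\<^sup>2 \<le> x \<bullet> x" "(x $ j)\<^sup>2 \<le> x \<bullet> x" using le by auto
    moreover have "2 * \<bar>x $ i * x $ j\<bar> \<le> (x $ i)\<^sup>2 + (x $ j)\<^sup>2"
      using sum_squares_bound[of "\<bar>x $ i\<bar>" "\<bar>x $ j\<bar>"] by (simp add: abs_mult)
    ultimately have "\<bar>x $ i * x $ j\<bar> \<le> x \<bullet> x" by linarith
    hence "\<bar>C $$ (i,j) * (x $ i * x $ j)\<bar> \<le> \<bar>C $$ (i,j)\<bar> * (x \<bullet> x)"
      unfolding abs_mult[of "C $$ (i,j)"] by (intro mult_left_mono) auto
    thus "C $$ (i,j) * (x $ i * x $ j) \<le> \<bar>C $$ (i,j)\<bar> * (x \<bullet> x)" by linarith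
  qed
  also have "\<dots> = K * (x \<bullet> x)" unfolding K_def by (simp add: sum_distrib_right)
  also have "\<dots> \<le> (K + 1) * (x \<bullet> x)" using xx by (simp add: algebra_simps sum_nonneg)
  finally show "x \<bullet> (C *\<^sub>v x) \<le> (K + 1) * (x \<bullet> x)" .
qed

lemma inverse_mat_exists:
  fixes B :: "'a :: field mat"
  assumes B: "B \<in> carrier_mat n n" and "det B \<noteq> 0"
  obtains C where "C \<in> carrier_mat n n" "B * C = 1\<^sub>m n" "C * B = 1\<^sub>m n"
  using det_non_zero_imp_unit[OF assms, of "()"]
  by (auto simp: Units_def ring_mat_simps)

text \<open>Put \<open>y = C x\<close> with \<open>C\<close> the inverse of \<open>B\<close>.
  Cauchy-Schwarz for the form bounds the square of \<open>x \<bullet> x\<close> by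
  \<open>x \<bullet> C x\<close> times the form at \<open>x\<close>, and the first factor is at most
  \<open>K\<close> times \<open>x \<bullet> x\<close>. Neither diagonalisation nor compactness of
  the sphere enters.\<close>

lemma psd_nonsingular_coercive:
  fixes B :: "real mat"
  assumes B: "B \<in> carrier_mat n n" and sym: "transpose_mat B = B"
    and psd: "\<And>x. x \<in> carrier_vec n \<Longrightarrow> 0 \<le> x \<bullet> (B *\<^sub>v x)"
    and det: "det B \<noteq> 0"
  obtains d where "d > 0" "\<And>x. x \<in> carrier_vec n \<Longrightarrow> d * (x \<bullet> x) \<le> x \<bullet> (B *\<^sub>v x)"
proof -
  obtain C where C: "C \<in> carrier_mat n n" "B * C = 1\<^sub>m n" "C * B = 1\<^sub>m n"
    using inverse_mat_exists[OF B det] .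
  obtain K where K: "K > 0" "\<And>x. x \<in> carrier_vec n \<Longrightarrow> x \<bullet> (C *\<^sub>v x) \<le> K * (x \<bullet> x)"
    using quadratic_form_bounded[OF C(1)] by blast
  show ?thesis
  proof (rule that[of "1 / K"])
    show "1 / K > 0" using K by simp
    fix x :: "real vec" assume x: "x \<in> carrier_vec n"
    define y where "y = C *\<^sub>v x"
    have y: "y \<in> carrier_vec n" unfolding y_def using C x by simp
    have By: "B *\<^sub>v y = x" unfolding y_def using assoc_mult_mat_vec[OF B C(1) x] C(2) x by simp
    have yBx: "y \<bullet> (B *\<^sub>v x) = x \<bullet> x"
      using transpose_vec_mult_scalar[OF B x y] sym By by simp
    have xx: "x \<bullet> x \<ge> 0" by (simp add: scalar_prod_def sum_nonneg)
    have "(x \<bullet> x)\<^sup>2 \<le> (y \<bullet> x) * (x \<bullet> (B *\<^sub>v x))"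
      using psd_Cauchy_Schwarz[OF B sym psd x y] yBx By by simp
    also have "\<dots> \<le> (K * (x \<bullet> x)) * (x \<bullet> (B *\<^sub>v x))"
      using K(2)[OF x] psd[OF x] comm_scalar_prod[OF x y] unfolding y_def[symmetric]
      by (intro mult_right_mono) auto
    finally have *: "(x \<bullet> x) * (x \<bullet> x) \<le> (x \<bullet> x) * (K * (x \<bullet> (B *\<^sub>v x)))"
      by (simp add: power2_eq_square mult_ac)
    have "x \<bullet> x \<le> K * (x \<bullet> (B *\<^sub>v x))"
    proof (cases "x \<bullet> x = 0")
      case True then show ?thesis using K psd[OF x] by simp
    next
      case False then show ?thesis using * xx by (simp add: mult_le_cancel_left)
    qed
    thus "1 / K * (x \<bullet> x) \<le> x \<bullet> (B *\<^sub>v x)" using K by (simp add: field_simps)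
  qed
qed


text \<open>Let \<open>t\<close> be the largest shift for which \<open>S - t I\<close> is still
  positive semidefinite. If the claim failed, \<open>t\<close> would lie in \<open>[0, s)\<close>,
  so \<open>S - t I\<close> would be nonsingular, hence coercive, and the shift could be increased.
  This replaces the spectral theorem.\<close>

lemma psd_ge_of_no_small_eigenvalue:
  fixes S :: "real mat"
  assumes S: "S \<in> carrier_mat n n" and sym: "transpose_mat S = S"
    and psd: "\<And>x. x \<in> carrier_vec n \<Longrightarrow> 0 \<le> x \<bullet> (S *\<^sub>v x)"
    and ev: "\<And>t. 0 \<le> t \<Longrightarrow> t < s \<Longrightarrow> \<not> eigenvalue S t"
    and x: "x \<in> carrier_vec n"
  shows "s * (x \<bullet> x) \<le> x \<bullet> (S *\<^sub>v x)"
proof (rule ccontr)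
  assume neg: "\<not> ?thesis"
  define P where "P = {t. 0 \<le> t \<and> (\<forall>y\<in>carrier_vec n. t * (y \<bullet> y) \<le> y \<bullet> (S *\<^sub>v y))}"
  have nn: "y \<bullet> y \<ge> 0" for y :: "real vec" by (simp add: scalar_prod_def sum_nonneg)
  have less: "t < s" if "t \<in> P" for t
  proof (rule ccontr)
    assume "\<not> t < s"
    hence "s * (x \<bullet> x) \<le> t * (x \<bullet> x)" using nn[of x] by (intro mult_right_mono) auto
    also have "\<dots> \<le> x \<bullet> (S *\<^sub>v x)" using that x unfolding P_def by blast
    finally show False using neg by simp
  qed
  have bdd: "bdd_above P" using less by (intro bdd_aboveI[of _ s]) (auto intro: less_imp_le)
  have P0: "0 \<in> P" unfolding P_def using psd by simp
  define t where "t = Sup P"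
  \<comment> \<open>The supremum is attained because every constraint is a closed condition on
    \<open>t\<close>.\<close>
  have tP: "t \<in> P"
  proof -
    have "0 \<le> t" unfolding t_def using P0 bdd by (rule cSup_upper)
    moreover have "t * (y \<bullet> y) \<le> y \<bullet> (S *\<^sub>v y)" if y: "y \<in> carrier_vec n" for y
    proof (cases "y \<bullet> y = 0")
      case True
      then show ?thesis using psd[OF y] by simp
    next
      case False
      hence pos: "y \<bullet> y > 0" using nn[of y] by simp
      have "t \<le> (y \<bullet> (S *\<^sub>v y)) / (y \<bullet> y)" unfolding t_def
      proof (rule cSup_least)
        show "P \<noteq> {}" using P0 by blast
        show "u \<le> (y \<bullet> (S *\<^sub>v y)) / (y \<bullet> y)" if "u \<in> P" for u
          using that y pos unfolding P_def by (simp add: pos_le_divide_eq)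
      qed
      then show ?thesis using pos by (simp add: pos_le_divide_eq)
    qed
    ultimately show ?thesis unfolding P_def by blast
  qed
  define B where "B = char_matrix S t"
  have B: "B \<in> carrier_mat n n" unfolding B_def using S by simp
  have det: "det B \<noteq> 0"
    using ev[of t] less[OF tP] tP eigenvalue_det[OF S] unfolding B_def P_def by auto
  have form: "y \<bullet> (B *\<^sub>v y) = y \<bullet> (S *\<^sub>v y) - t * (y \<bullet> y)" if y: "y \<in> carrier_vec n" for y
  proof -
    have "((-t) \<cdot>\<^sub>m 1\<^sub>m n) *\<^sub>v y = (-t) \<cdot>\<^sub>v y"
      using y by (intro eq_vecI) (auto simp: scalar_prod_def if_distrib if_distribR sum.delta cong: if_cong)
    hence "B *\<^sub>v y = S *\<^sub>v y + (-t) \<cdot>\<^sub>v y"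
      unfolding B_def char_matrix_def using S y
      by (simp add: add_mult_distrib_mat_vec[of _ n n])
    thus ?thesis using S y by (simp add: scalar_prod_add_distrib[of _ n])
  qed
  have "transpose_mat ((-t) \<cdot>\<^sub>m 1\<^sub>m n) = (-t) \<cdot>\<^sub>m 1\<^sub>m n" by (intro eq_matI) auto
  hence symB: "transpose_mat B = B"
    unfolding B_def char_matrix_def using S sym by (simp add: transpose_add[of _ n n])
  have psdB: "0 \<le> y \<bullet> (B *\<^sub>v y)" if y: "y \<in> carrier_vec n" for y
    using form[OF y] tP y unfolding P_def by auto
  obtain d where d: "d > 0" "\<And>y. y \<in> carrier_vec n \<Longrightarrow> d * (y \<bullet> y) \<le> y \<bullet> (B *\<^sub>v y)"
    using psd_nonsingular_coercive[OF B symB psdB det] by blast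
  have "t + d \<in> P"
    using tP d form unfolding P_def by (auto simp: algebra_simps)
  hence "t + d \<le> t" unfolding t_def using bdd by (rule cSup_upper)
  thus False using d by simp
qed

text \<open>The singular values are the square roots of the eigenvalues of the square of
  \<open>S\<close>. An eigenvalue \<open>t \<ge> 0\<close> of \<open>S\<close> contributes
  \<open>t\<close> itself to that list, so none lies in \<open>[0, sigma n S)\<close> and the
  preceding bound applies.\<close>

lemma sigma_min_psd:
  fixes S :: "real mat"
  assumes S: "S \<in> carrier_mat n n" and sym: "transpose_mat S = S"
    and psd: "\<And>x. x \<in> carrier_vec n \<Longrightarrow> 0 \<le> x \<bullet> (S *\<^sub>v x)"
    and n: "n \<ge> 1"
  shows "sigma n S \<ge> 0"
    and "\<And>x. x \<in> carrier_vec n \<Longrightarrow> sigma n S * (x \<bullet> x) \<le> x \<bullet> (S *\<^sub>v x)"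
proof -
  define B where "B = transpose_mat S * S"
  have B: "B \<in> carrier_mat n n" unfolding B_def using S by simp
  have symB: "transpose_mat B = B" unfolding B_def using S sym by (simp add: transpose_mult[of _ n n])
  define q where "q = char_poly B"
  have deg: "degree q = n" and q0: "q \<noteq> 0"
    using degree_monic_char_poly[OF B] unfolding q_def by auto
  have size: "size (proots q) = n"
    using size_proots_eq_degree_real[of q] char_poly_symmetric_real_roots[OF B symB] deg
    unfolding q_def by blast
  define L where "L = sorted_list_of_multiset (image_mset sqrt (proots q))"
  have len: "length L = n" using size unfolding L_def by (metis size_image_mset size_mset mset_sorted_list_of_multiset)
  have sorted: "sorted L" unfolding L_def by simp
  have set: "set L = sqrt ` {t. eigenvalue B t}"
    unfolding L_def using q0 eigenvalue_root_char_poly[OF B] by (simp add: q_def)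
  \<comment> \<open>\<open>singular_values\<close> is decreasing, so position \<open>n - 1\<close>
    holds the head of the increasing list \<open>L\<close>.\<close>
  have sig: "sigma n S = L ! 0"
    using n len unfolding sigma_def singular_values_def B_def[symmetric] q_def[symmetric] L_def[symmetric]
    by (simp add: rev_nth)
  have least: "sigma n S \<le> u" if u: "u \<in> set L" for u
  proof -
    obtain i where "i < length L" "u = L ! i" using u by (auto simp: in_set_conv_nth)
    thus ?thesis using sorted sig by (simp add: sorted_nth_mono)
  qed
  have "sigma n S \<in> set L" using sig len n by simp
  then obtain l where l: "sigma n S = sqrt l" "eigenvalue B l" using set by auto
  obtain v where v: "v \<in> carrier_vec n" "v \<noteq> 0\<^sub>v n" "B *\<^sub>v v = l \<cdot>\<^sub>v v"
    using l(2) B unfolding eigenvalue_def eigenvector_def by auto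
  have nn: "y \<bullet> y \<ge> 0" for y :: "real vec" by (simp add: scalar_prod_def sum_nonneg)
  have "v \<bullet> v \<noteq> 0"
  proof -
    obtain k where k: "k < n" "v $ k \<noteq> 0" using v(1,2) by (metis eq_vecI carrier_vecD index_zero_vec)
    have "(\<Sum>i<n. v $ i * v $ i) > 0" using k
      by (intro sum_pos2[of _ k]) (auto simp: zero_less_mult_iff not_less)
    thus ?thesis using v(1) by (simp add: scalar_prod_def lessThan_atLeast0)
  qed
  \<comment> \<open>\<open>sqrt\<close> of a negative real is negative, so \<open>l \<ge> 0\<close>
    is shown separately: \<open>l * (v \<bullet> v)\<close> is the squared norm of
    \<open>S v\<close>.\<close>
  have "l * (v \<bullet> v) = v \<bullet> (B *\<^sub>v v)" using v by simp
  also have "\<dots> = v \<bullet> (S *\<^sub>v (S *\<^sub>v v))"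
    unfolding B_def using S sym v(1) by simp
  also have "\<dots> = (S *\<^sub>v v) \<bullet> (S *\<^sub>v v)"
    using transpose_vec_mult_scalar[OF S, of "S *\<^sub>v v" v] sym S v(1) 
    by (metis mult_mat_vec_carrier comm_scalar_prod)
  finally have "l * (v \<bullet> v) \<ge> 0" using nn by simp
  hence "l \<ge> 0" using nn[of v] \<open>v \<bullet> v \<noteq> 0\<close> by (simp add: zero_le_mult_iff)
  thus "sigma n S \<ge> 0" using l by simp
  have ev: "\<not> eigenvalue S t" if "0 \<le> t" "t < sigma n S" for t
  proof
    assume "eigenvalue S t"
    then obtain v where v: "v \<in> carrier_vec n" "v \<noteq> 0\<^sub>v n" "S *\<^sub>v v = t \<cdot>\<^sub>v v"
      unfolding eigenvalue_def eigenvector_def using S by auto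
    have "B *\<^sub>v v = S *\<^sub>v (S *\<^sub>v v)" unfolding B_def using S sym v(1) by simp
    also have "\<dots> = t\<^sup>2 \<cdot>\<^sub>v v"
      using v S by (simp add: mult_mat_vec[of _ n n] smult_smult_assoc power2_eq_square)
    finally have "eigenvalue B (t\<^sup>2)" unfolding eigenvalue_def eigenvector_def using v B by auto
    hence "sqrt (t\<^sup>2) \<in> set L" using set by blast
    hence "sigma n S \<le> t" using least that by force
    thus False using that by simp
  qed
  show "\<And>x. x \<in> carrier_vec n \<Longrightarrow> sigma n S * (x \<bullet> x) \<le> x \<bullet> (S *\<^sub>v x)"
    using psd_ge_of_no_small_eigenvalue[OF S sym psd ev] by blast
qed

section \<open>Square-integrable functions and domination of sums of measures\<close>

text \<open>Measurability of \<open>u\<close> is a separate conjunct because it does not follow from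
  measurability of the square.\<close>

definition square_integrable :: "'a measure \<Rightarrow> ('a \<Rightarrow> real) \<Rightarrow> bool" where
  "square_integrable M u \<longleftrightarrow> u \<in> borel_measurable M \<and> integrable M (\<lambda>x. (u x)\<^sup>2)"

lemma square_integrable_mult:
  assumes "square_integrable M u" "square_integrable M v"
  shows "integrable M (\<lambda>x. u x * v x)"
proof (rule Bochner_Integration.integrable_bound)
  show "integrable M (\<lambda>x. (u x)\<^sup>2 + (v x)\<^sup>2)"
    using assms unfolding square_integrable_def by auto
  show "(\<lambda>x. u x * v x) \<in> borel_measurable M"
    using assms unfolding square_integrable_def by auto
  have "\<bar>u x * v x\<bar> \<le> (u x)\<^sup>2 + (v x)\<^sup>2" for x
  proof -
    have "2 * \<bar>u x * v x\<bar> \<le> (u x)\<^sup>2 + (v x)\<^sup>2"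
      using sum_squares_bound[of "\<bar>u x\<bar>" "\<bar>v x\<bar>"] by (simp add: abs_mult)
    thus ?thesis by linarith
  qed
  thus "AE x in M. norm (u x * v x) \<le> norm ((u x)\<^sup>2 + (v x)\<^sup>2)" by (intro AE_I2) auto
qed

lemma square_integrable_cmult:
  "square_integrable M u \<Longrightarrow> square_integrable M (\<lambda>x. c * u x)"
  unfolding square_integrable_def by (auto simp: power_mult_distrib)

lemma square_integrable_add:
  assumes "square_integrable M u" "square_integrable M v"
  shows "square_integrable M (\<lambda>x. u x + v x)"
  using assms square_integrable_mult[OF assms]
  unfolding square_integrable_def by (auto simp: power2_sum mult.assoc)

lemma square_integrable_diff:
  assumes "square_integrable M u" "square_integrable M v"
  shows "square_integrable M (\<lambda>x. u x - v x)"
  using square_integrable_add[OF assms(1) square_integrable_cmult[OF assms(2), of "-1"]] by simp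

lemma square_integrable_sum:
  assumes "\<And>i. i < p \<Longrightarrow> square_integrable M (u i)"
  shows "square_integrable M (\<lambda>x. \<Sum>i<(p::nat). u i x)"
  using assms
proof (induction p)
  case 0
  then show ?case by (simp add: square_integrable_def)
next
  case (Suc p)
  then show ?case by (simp add: square_integrable_add)
qed

lemma square_integrable_lincomb:
  assumes "\<And>i. i < p \<Longrightarrow> square_integrable M (\<lambda>x. f x i)"
  shows "square_integrable M (\<lambda>x. inner_p p a (f x))"
    and "square_integrable M (\<lambda>x. inner_p p (f x) a)"
proof -
  show *: "square_integrable M (\<lambda>x. inner_p p a (f x))"
    unfolding inner_p_def using assms by (intro square_integrable_sum square_integrable_cmult)
  thus "square_integrable M (\<lambda>x. inner_p p (f x) a)"
    by (simp add: inner_p_def mult.commute)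
qed

lemma integral_Cauchy_Schwarz:
  assumes u: "square_integrable M u" and v: "square_integrable M v"
  shows "(\<integral>x. u x * v x \<partial>M)\<^sup>2 \<le> (\<integral>x. (u x)\<^sup>2 \<partial>M) * (\<integral>x. (v x)\<^sup>2 \<partial>M)"
proof (rule quadratic_nonneg_discriminant)
  have iu: "integrable M (\<lambda>x. (u x)\<^sup>2)" and iv: "integrable M (\<lambda>x. (v x)\<^sup>2)"
    using u v by (auto simp: square_integrable_def)
  fix t
  have "0 \<le> (\<integral>x. (u x + t * v x)\<^sup>2 \<partial>M)" by simp
  also have "\<dots> = (\<integral>x. ((u x)\<^sup>2 + 2 * t * (u x * v x)) + t\<^sup>2 * (v x)\<^sup>2 \<partial>M)"
    by (intro Bochner_Integration.integral_cong) (auto simp: power2_sum power_mult_distrib)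
  also have "\<dots> = (\<integral>x. (u x)\<^sup>2 \<partial>M) + 2 * t * (\<integral>x. u x * v x \<partial>M) + t\<^sup>2 * (\<integral>x. (v x)\<^sup>2 \<partial>M)"
    using iu iv square_integrable_mult[OF u v] by simp
  finally show "0 \<le> \<dots>" .
qed simp

text \<open>Turns pairings with a function in the span of \<open>f\<close> into inner products of
  coefficient vectors, so that later arguments become finite-dimensional linear algebra.\<close>

lemma integral_lincomb_mult:
  assumes f: "\<And>i. i < p \<Longrightarrow> square_integrable M (\<lambda>x. f x i)" and u: "square_integrable M u"
  shows "(\<integral>x. inner_p p a (f x) * u x \<partial>M) = inner_p p a (\<lambda>i. \<integral>x. f x i * u x \<partial>M)"
proof -
  have int: "integrable M (\<lambda>x. a i * (f x i * u x))" if "i < p" for i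
    using square_integrable_mult[OF f[OF that] u] by simp
  have "(\<integral>x. inner_p p a (f x) * u x \<partial>M) = (\<integral>x. (\<Sum>i<p. a i * (f x i * u x)) \<partial>M)"
    unfolding inner_p_def by (simp add: sum_distrib_right mult.assoc)
  also have "\<dots> = (\<Sum>i<p. \<integral>x. a i * (f x i * u x) \<partial>M)"
    using int by (intro Bochner_Integration.integral_sum) auto
  finally show ?thesis unfolding inner_p_def by simp
qed

lemma inner_p_commute: "inner_p p x y = inner_p p y x"
  unfolding inner_p_def by (simp add: mult.commute)

section \<open>Integrals over product spaces\<close>

lemma integrable_pair_mult:
  fixes u :: "'a \<Rightarrow> real" and v :: "'b \<Rightarrow> real"
  assumes "prob_space M" "prob_space N" and u: "integrable M u" and v: "integrable N v"
  shows "integrable (M \<Otimes>\<^sub>M N) (\<lambda>(x, y). u x * v y)"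
    and "(\<integral>(x, y). u x * v y \<partial>(M \<Otimes>\<^sub>M N)) = (\<integral>x. u x \<partial>M) * (\<integral>y. v y \<partial>N)"
proof -
  interpret M: prob_space M by fact
  interpret N: prob_space N by fact
  interpret MN: pair_prob_space M N ..
  note [measurable] = borel_measurable_integrable[OF u] borel_measurable_integrable[OF v]
  show int: "integrable (M \<Otimes>\<^sub>M N) (\<lambda>(x, y). u x * v y)"
  proof (rule MN.Fubini_integrable)
    show "integrable M (\<lambda>x. \<integral>y. norm ((\<lambda>(x, y). u x * v y) (x, y)) \<partial>N)"
      using u v by (simp add: abs_mult)
  qed (use u v in auto)
  show "(\<integral>(x, y). u x * v y \<partial>(M \<Otimes>\<^sub>M N)) = (\<integral>x. u x \<partial>M) * (\<integral>y. v y \<partial>N)"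
    using MN.integral_fst'[OF int] by simp
qed

lemma square_integrable_pair_inner:
  fixes f :: "'a \<Rightarrow> nat \<Rightarrow> real" and g :: "'b \<Rightarrow> nat \<Rightarrow> real"
  assumes "prob_space M" "prob_space N"
    and f: "\<And>i. i < p \<Longrightarrow> square_integrable M (\<lambda>x. f x i)"
    and g: "\<And>i. i < p \<Longrightarrow> square_integrable N (\<lambda>x. g x i)"
  shows "square_integrable (M \<Otimes>\<^sub>M N) (\<lambda>(x, y). inner_p p (f x) (g y))"
proof -
  have "square_integrable (M \<Otimes>\<^sub>M N) (\<lambda>(x, y). f x i * g y i)" if "i < p" for i
  proof -
    have [measurable]: "(\<lambda>x. f x i) \<in> borel_measurable M" "(\<lambda>x. g x i) \<in> borel_measurable N"
      using f g that by (auto simp: square_integrable_def)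
    have "integrable (M \<Otimes>\<^sub>M N) (\<lambda>(x, y). (f x i)\<^sup>2 * (g y i)\<^sup>2)"
      using f g that by (intro integrable_pair_mult assms) (auto simp: square_integrable_def)
    thus ?thesis unfolding square_integrable_def
      by (auto simp: case_prod_beta' power_mult_distrib)
  qed
  from square_integrable_sum[of p, OF this] show ?thesis
    by (simp add: inner_p_def case_prod_beta')
qed

text \<open>Fubini for the squared kernel in both orders: integrating the squared norms of its rows
  or of its columns gives the squared Hilbert-Schmidt norm.\<close>

lemma square_integrable_pair_sections:
  fixes K :: "'a \<Rightarrow> 'b \<Rightarrow> real"
  assumes "prob_space M" "prob_space N"
    and K: "square_integrable (M \<Otimes>\<^sub>M N) (\<lambda>(x, y). K x y)"
  shows "integrable M (\<lambda>x. \<integral>y. (K x y)\<^sup>2 \<partial>N)"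
    and "(\<integral>x. \<integral>y. (K x y)\<^sup>2 \<partial>N \<partial>M) = (\<integral>(x, y). (K x y)\<^sup>2 \<partial>(M \<Otimes>\<^sub>M N))"
    and "integrable N (\<lambda>y. \<integral>x. (K x y)\<^sup>2 \<partial>M)"
    and "(\<integral>y. \<integral>x. (K x y)\<^sup>2 \<partial>M \<partial>N) = (\<integral>(x, y). (K x y)\<^sup>2 \<partial>(M \<Otimes>\<^sub>M N))"
proof -
  interpret M: prob_space M by fact
  interpret N: prob_space N by fact
  interpret MN: pair_prob_space M N ..
  interpret NM: pair_prob_space N M ..
  have int: "integrable (M \<Otimes>\<^sub>M N) (\<lambda>(x, y). (K x y)\<^sup>2)"
    using K by (simp add: square_integrable_def case_prod_beta')
  show "integrable M (\<lambda>x. \<integral>y. (K x y)\<^sup>2 \<partial>N)" using MN.integrable_fst'[OF int] by simp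
  show "(\<integral>x. \<integral>y. (K x y)\<^sup>2 \<partial>N \<partial>M) = (\<integral>(x, y). (K x y)\<^sup>2 \<partial>(M \<Otimes>\<^sub>M N))"
    using MN.integral_fst'[OF int] by simp
  have swap: "integrable (N \<Otimes>\<^sub>M M) (\<lambda>(y, x). (K x y)\<^sup>2)"
    using MN.integrable_product_swap[OF int] by simp
  show "integrable N (\<lambda>y. \<integral>x. (K x y)\<^sup>2 \<partial>M)" using NM.integrable_fst'[OF swap] by simp
  show "(\<integral>y. \<integral>x. (K x y)\<^sup>2 \<partial>M \<partial>N) = (\<integral>(x, y). (K x y)\<^sup>2 \<partial>(M \<Otimes>\<^sub>M N))"
    using NM.integral_fst'[OF swap] MN.integral_product_swap[OF borel_measurable_integrable[OF int]] by simp
qed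

section \<open>Integrals under setwise domination of sums of measures\<close>

text \<open>The inequality holds for indicators and is stable under scaling, addition and increasing
  limits. Sums of integrals stand in for integrals against a sum measure, matching the setwise form
  of \<open>comb_dens_le\<close>.\<close>

lemma nn_integral_sum_measures_mono:
  fixes M :: "'i \<Rightarrow> 'a measure" and N :: "'j \<Rightarrow> 'a measure" and c :: ennreal
  assumes M: "\<And>i. i \<in> I \<Longrightarrow> sets (M i) = sets L" and N: "\<And>j. j \<in> J \<Longrightarrow> sets (N j) = sets L"
    and le: "\<And>A. A \<in> sets L \<Longrightarrow> (\<Sum>i\<in>I. emeasure (M i) A) \<le> c * (\<Sum>j\<in>J. emeasure (N j) A)"
    and u: "u \<in> borel_measurable L"
  shows "(\<Sum>i\<in>I. \<integral>\<^sup>+x. u x \<partial>M i) \<le> c * (\<Sum>j\<in>J. \<integral>\<^sup>+x. u x \<partial>N j)"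
proof -
  have meas: "f \<in> borel_measurable (M i) \<longleftrightarrow> f \<in> borel_measurable L" if "i \<in> I" for i and f :: "'a \<Rightarrow> ennreal"
    using measurable_cong_sets[OF M[OF that] refl] by blast
  have meas': "f \<in> borel_measurable (N j) \<longleftrightarrow> f \<in> borel_measurable L" if "j \<in> J" for j and f :: "'a \<Rightarrow> ennreal"
    using measurable_cong_sets[OF N[OF that] refl] by blast
  from u show ?thesis
  proof (induction rule: borel_measurable_induct)
    case (cong f g)
    have "(\<integral>\<^sup>+x. f x \<partial>M i) = (\<integral>\<^sup>+x. g x \<partial>M i)" if "i \<in> I" for i
      using cong(3) sets_eq_imp_space_eq[OF M[OF that]] by (intro nn_integral_cong) auto
    moreover have "(\<integral>\<^sup>+x. f x \<partial>N i) = (\<integral>\<^sup>+x. g x \<partial>N i)" if "i \<in> J" for i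
      using cong(3) sets_eq_imp_space_eq[OF N[OF that]] by (intro nn_integral_cong) auto
    ultimately show ?case using cong(4) by simp
  next
    case (set A)
    then show ?case using le[of A] M N by simp
  next
    case (mult u d)
    have "(\<Sum>i\<in>I. \<integral>\<^sup>+x. d * u x \<partial>M i) = d * (\<Sum>i\<in>I. \<integral>\<^sup>+x. u x \<partial>M i)"
      using mult meas by (simp add: nn_integral_cmult sum_distrib_left)
    also have "\<dots> \<le> d * (c * (\<Sum>j\<in>J. \<integral>\<^sup>+x. u x \<partial>N j))" using mult by (intro mult_left_mono) auto
    also have "\<dots> = c * (\<Sum>j\<in>J. \<integral>\<^sup>+x. d * u x \<partial>N j)"
      using mult meas' by (simp add: nn_integral_cmult sum_distrib_left mult_ac)
    finally show ?case .
  next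
    case (add u v)
    have "(\<Sum>i\<in>I. \<integral>\<^sup>+x. v x + u x \<partial>M i) = (\<Sum>i\<in>I. \<integral>\<^sup>+x. v x \<partial>M i) + (\<Sum>i\<in>I. \<integral>\<^sup>+x. u x \<partial>M i)"
      using add meas by (simp add: nn_integral_add sum.distrib)
    also have "\<dots> \<le> c * (\<Sum>j\<in>J. \<integral>\<^sup>+x. v x \<partial>N j) + c * (\<Sum>j\<in>J. \<integral>\<^sup>+x. u x \<partial>N j)"
      using add by (intro add_mono) auto
    also have "\<dots> = c * (\<Sum>j\<in>J. \<integral>\<^sup>+x. v x + u x \<partial>N j)"
      using add meas' by (simp add: nn_integral_add sum.distrib distrib_left)
    finally show ?case .
  next
    case (seq U)
    have inc: "incseq (\<lambda>n. \<integral>\<^sup>+x. U n x \<partial>K)" for K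
      using seq(3) by (auto simp: incseq_def le_fun_def intro!: nn_integral_mono)
    have conv: "(\<integral>\<^sup>+x. (SUP n. U n) x \<partial>M i) = (SUP n. \<integral>\<^sup>+x. U n x \<partial>M i)" if "i \<in> I" for i
      unfolding SUP_apply using seq that meas by (intro nn_integral_monotone_convergence_SUP) auto
    have conv': "(\<integral>\<^sup>+x. (SUP n. U n) x \<partial>N i) = (SUP n. \<integral>\<^sup>+x. U n x \<partial>N i)" if "i \<in> J" for i
      unfolding SUP_apply using seq that meas' by (intro nn_integral_monotone_convergence_SUP) auto
    \<comment> \<open>The finite sum commutes with the supremum because all the sequences are
      increasing.\<close>
    have "(\<Sum>i\<in>I. \<integral>\<^sup>+x. (SUP n. U n) x \<partial>M i) = (SUP n. \<Sum>i\<in>I. \<integral>\<^sup>+x. U n x \<partial>M i)"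
      using conv inc by (simp add: ennreal_SUP_sum)
    also have "\<dots> \<le> c * (\<Sum>j\<in>J. \<integral>\<^sup>+x. (SUP n. U n) x \<partial>N j)"
    proof (rule SUP_least)
      fix n
      have "(\<Sum>i\<in>I. \<integral>\<^sup>+x. U n x \<partial>M i) \<le> c * (\<Sum>j\<in>J. \<integral>\<^sup>+x. U n x \<partial>N j)" by (rule seq)
      also have "\<dots> \<le> c * (\<Sum>j\<in>J. \<integral>\<^sup>+x. (SUP n. U n) x \<partial>N j)"
        using conv' by (intro mult_left_mono sum_mono) (auto intro: SUP_upper)
      finally show "(\<Sum>i\<in>I. \<integral>\<^sup>+x. U n x \<partial>M i) \<le> c * (\<Sum>j\<in>J. \<integral>\<^sup>+x. (SUP n. U n) x \<partial>N j)" .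
    qed
    finally show ?case by (simp add: image_comp)
  qed
qed

text \<open>Finiteness identifies \<open>measure\<close> with \<open>emeasure\<close> and
  integrability identifies the two kinds of integral, so the extended-real version
  transfers.\<close>

lemma integral_sum_measures_mono:
  fixes M :: "'i \<Rightarrow> 'a measure" and N :: "'j \<Rightarrow> 'a measure" and c :: real
  assumes "c \<ge> 0" and "\<And>i. i \<in> I \<Longrightarrow> finite_measure (M i)" "\<And>j. j \<in> J \<Longrightarrow> finite_measure (N j)"
    and M: "\<And>i. i \<in> I \<Longrightarrow> sets (M i) = sets L" and N: "\<And>j. j \<in> J \<Longrightarrow> sets (N j) = sets L"
    and le: "\<And>A. A \<in> sets L \<Longrightarrow> (\<Sum>i\<in>I. measure (M i) A) \<le> c * (\<Sum>j\<in>J. measure (N j) A)"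
    and uM: "\<And>i. i \<in> I \<Longrightarrow> integrable (M i) u" and uN: "\<And>j. j \<in> J \<Longrightarrow> integrable (N j) u"
    and u: "u \<in> borel_measurable L" "\<And>x. u x \<ge> 0"
  shows "(\<Sum>i\<in>I. \<integral>x. u x \<partial>M i) \<le> c * (\<Sum>j\<in>J. \<integral>x. u x \<partial>N j)"
proof -
  have "(\<Sum>i\<in>I. emeasure (M i) A) \<le> ennreal c * (\<Sum>j\<in>J. emeasure (N j) A)" if "A \<in> sets L" for A
    using le[OF that] assms(1-3)
    by (simp add: finite_measure.emeasure_eq_measure ennreal_mult[symmetric] sum_nonneg ennreal_leI)
  hence "(\<Sum>i\<in>I. \<integral>\<^sup>+x. ennreal (u x) \<partial>M i) \<le> ennreal c * (\<Sum>j\<in>J. \<integral>\<^sup>+x. ennreal (u x) \<partial>N j)"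
    using u M N by (intro nn_integral_sum_measures_mono[of I M L]) auto
  hence "ennreal (\<Sum>i\<in>I. \<integral>x. u x \<partial>M i) \<le> ennreal (c * (\<Sum>j\<in>J. \<integral>x. u x \<partial>N j))"
    using uM uN u(2) assms(1)
    by (simp add: nn_integral_eq_integral ennreal_mult[symmetric] sum_nonneg)
  thus ?thesis using assms(1) u(2) by (simp add: sum_nonneg)
qed

section \<open>Gram matrices\<close>

text \<open>The matrix with rows \<open>C i\<close> is square with trivial kernel, hence invertible;
  \<open>X\<close> applies its inverse.\<close>

lemma right_inverse_exists:
  fixes C :: "nat \<Rightarrow> nat \<Rightarrow> real"
  assumes inj: "\<And>a. (\<And>i. i < p \<Longrightarrow> inner_p p (C i) a = 0) \<Longrightarrow> (\<forall>k<p. a k = 0)"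
  obtains X where "\<And>y i. i < p \<Longrightarrow> inner_p p (C i) (X y) = y i"
proof -
  define A where "A = mat p p (\<lambda>(i, k). C i k)"
  have A: "A \<in> carrier_mat p p" unfolding A_def by simp
  have row: "(A *\<^sub>v v) $ i = inner_p p (C i) (\<lambda>k. v $ k)" if "v \<in> carrier_vec p" "i < p" for v i
    using that unfolding A_def by (simp add: scalar_prod_def inner_p_def lessThan_atLeast0)
  have "det A \<noteq> 0"
  proof
    assume "det A = 0"
    then obtain v where v: "v \<in> carrier_vec p" "v \<noteq> 0\<^sub>v p" "A *\<^sub>v v = 0\<^sub>v p"
      using det_0_iff_vec_prod_zero_field[OF A] by blast
    have "\<forall>k<p. v $ k = 0" using row[OF v(1)] v(3) by (intro inj) simp
    thus False using v(1,2) by (auto intro: eq_vecI)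
  qed
  then obtain B where B: "B \<in> carrier_mat p p" "A * B = 1\<^sub>m p"
    using inverse_mat_exists[OF A] by blast
  show ?thesis
  proof (rule that[of "\<lambda>y k. (B *\<^sub>v vec p y) $ k"])
    fix y :: "nat \<Rightarrow> real" and i assume i: "i < p"
    have "A *\<^sub>v (B *\<^sub>v vec p y) = vec p y"
      using assoc_mult_mat_vec[OF A B(1), of "vec p y"] B(2) by simp
    thus "inner_p p (C i) (\<lambda>k. (B *\<^sub>v vec p y) $ k) = y i"
      using row[of "B *\<^sub>v vec p y" i] B(1) i by simp
  qed
qed

text \<open>The quadratic form of the second-moment matrix at \<open>a\<close> is the squared norm
  of the function \<open>inner_p p a (f x)\<close>, so its least singular value bounds norms on the
  span of \<open>f\<close> from below. Later arguments see the matrix only through these two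
  facts.\<close>

lemma sigma_second_moment:
  fixes f :: "'a \<Rightarrow> nat \<Rightarrow> real"
  assumes f: "\<And>i. i < p \<Longrightarrow> square_integrable M (\<lambda>x. f x i)" and p: "p \<ge> 1"
  shows "sigma p (second_moment p M f) \<ge> 0"
    and "sigma p (second_moment p M f) * inner_p p a a \<le> (\<integral>x. (inner_p p a (f x))\<^sup>2 \<partial>M)"
proof -
  let ?S = "second_moment p M f"
  have S: "?S \<in> carrier_mat p p" by (simp add: second_moment_def)
  have sym: "transpose_mat ?S = ?S"
    by (intro eq_matI) (auto simp: second_moment_def mult.commute)
  have form: "x \<bullet> (?S *\<^sub>v x) = (\<integral>w. (inner_p p (\<lambda>k. x $ k) (f w))\<^sup>2 \<partial>M)"
    if x: "x \<in> carrier_vec p" for x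
  proof -
    let ?u = "\<lambda>w. inner_p p (\<lambda>k. x $ k) (f w)"
    have u: "square_integrable M ?u" using f by (rule square_integrable_lincomb)
    have "(\<integral>w. f w i * ?u w \<partial>M) = inner_p p (\<lambda>k. x $ k) (\<lambda>k. \<integral>w. f w k * f w i \<partial>M)"
      if "i < p" for i
      using integral_lincomb_mult[of p M f "\<lambda>w. f w i" "\<lambda>k. x $ k", OF f f[OF that]] by (simp add: mult.commute)
    hence "(\<integral>w. f w i * ?u w \<partial>M) = (?S *\<^sub>v x) $ i" if "i < p" for i
      using that x by (simp add: second_moment_def scalar_prod_def inner_p_def lessThan_atLeast0 mult.commute)
    hence "(\<Sum>i<p. x $ i * (\<integral>w. f w i * ?u w \<partial>M)) = (\<Sum>i<p. x $ i * (?S *\<^sub>v x) $ i)"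
      by (intro sum.cong) auto
    also have "\<dots> = x \<bullet> (?S *\<^sub>v x)" using S by (simp add: scalar_prod_def[of x] lessThan_atLeast0)
    finally show ?thesis using integral_lincomb_mult[of p M f ?u "\<lambda>k. x $ k", OF f u]
      unfolding inner_p_def[of p _ "\<lambda>i. \<integral>w. f w i * ?u w \<partial>M"] by (simp add: power2_eq_square)
  qed
  have psd: "0 \<le> x \<bullet> (?S *\<^sub>v x)" if "x \<in> carrier_vec p" for x
    using form[OF that] by simp
  show "sigma p ?S \<ge> 0" using sigma_min_psd(1)[OF S sym psd p] .
  have "vec p a \<bullet> vec p a = inner_p p a a"
    by (simp add: scalar_prod_def inner_p_def lessThan_atLeast0)
  moreover have "inner_p p (\<lambda>k. vec p a $ k) (f w) = inner_p p a (f w)" for w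
    by (simp add: inner_p_def)
  ultimately show "sigma p ?S * inner_p p a a \<le> (\<integral>x. (inner_p p a (f x))\<^sup>2 \<partial>M)"
    using sigma_min_psd(2)[OF S sym psd p, of "vec p a"] form[of "vec p a"] by simp
qed

lemma inner_p_self_nonneg: "inner_p p a a \<ge> 0"
  unfolding inner_p_def by (simp add: sum_nonneg)

lemma inner_p_self_eq_0: "inner_p p a a = 0 \<longleftrightarrow> (\<forall>k<p. a k = 0)"
  unfolding inner_p_def by (subst sum_nonneg_eq_0_iff) auto

text \<open>In matrix form: \<open>T \<ge> t I\<close> implies \<open>T\<^sup>2 \<ge> t T\<close>.\<close>
lemma gram_square_ge:
  fixes f :: "'a \<Rightarrow> nat \<Rightarrow> real"
  assumes f: "\<And>i. i < p \<Longrightarrow> square_integrable M (\<lambda>x. f x i)"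
    and t: "t \<ge> 0" "t * inner_p p a a \<le> (\<integral>x. (inner_p p a (f x))\<^sup>2 \<partial>M)"
  defines "b \<equiv> \<lambda>i. \<integral>x. f x i * inner_p p a (f x) \<partial>M"
  shows "t * (\<integral>x. (inner_p p a (f x))\<^sup>2 \<partial>M) \<le> inner_p p b b"
proof -
  define n where "n = (\<integral>x. (inner_p p a (f x))\<^sup>2 \<partial>M)"
  have n: "n = inner_p p a b"
    using integral_lincomb_mult[of p M f _ a, OF f square_integrable_lincomb(1)[of p M f a, OF f]]
    unfolding n_def b_def by (simp add: power2_eq_square)
  have n0: "n \<ge> 0" unfolding n_def by simp
  \<comment> \<open>With \<open>T\<close> the Gram matrix, \<open>b = T a\<close> and
    \<open>n = a \<bullet> T a\<close>. Cauchy-Schwarz for \<open>a\<close> and \<open>b\<close> is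
    then combined with the bound of \<open>t\<close> times the squared norm of \<open>a\<close> by
    \<open>n\<close>.\<close>
  have "n\<^sup>2 \<le> inner_p p a a * inner_p p b b"
    using Cauchy_Schwarz_ineq_sum[of a b "{..<p}"] unfolding n inner_p_def by (simp add: power2_eq_square)
  hence "t * n\<^sup>2 \<le> t * (inner_p p a a * inner_p p b b)" using t(1) by (rule mult_left_mono)
  also have "\<dots> \<le> n * inner_p p b b"
    using t(2) inner_p_self_nonneg[of p b] unfolding n_def[symmetric] mult.assoc[symmetric]
    by (rule mult_right_mono)
  finally have *: "n * (t * n) \<le> n * inner_p p b b" by (simp add: power2_eq_square mult_ac)
  have "t * n \<le> inner_p p b b"
  proof (cases "n = 0")
    case True then show ?thesis using inner_p_self_nonneg by simp
  next
    case False then show ?thesis using * n0 by (simp add: mult_le_cancel_left)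
  qed
  thus ?thesis unfolding n_def .
qed

text \<open>The coefficients solve the linear system of the cross-Gram matrix \<open>C\<close> of
  \<open>u\<close> and \<open>g\<close>, which \<open>inj\<close> makes invertible. It is applied
  with both families equal to \<open>f\<close>, and with \<open>gh\<close> tested against the span
  of \<open>g\<close>.\<close>

lemma dual_lincomb_exists:
  fixes u g :: "'a \<Rightarrow> nat \<Rightarrow> real"
  assumes u: "\<And>i. i < p \<Longrightarrow> square_integrable M (\<lambda>x. u x i)"
    and g: "\<And>i. i < p \<Longrightarrow> square_integrable M (\<lambda>x. g x i)"
    and inj: "\<And>a. (\<And>i. i < p \<Longrightarrow> (\<integral>x. u x i * inner_p p a (g x) \<partial>M) = 0) \<Longrightarrow> (\<forall>k<p. a k = 0)"
  obtains X where "\<And>y i. i < p \<Longrightarrow> (\<integral>x. u x i * inner_p p (X y) (g x) \<partial>M) = y i"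
proof -
  define C where "C i k = (\<integral>x. g x k * u x i \<partial>M)" for i k
  have C: "(\<integral>x. u x i * inner_p p a (g x) \<partial>M) = inner_p p (C i) a" if "i < p" for i a
    using integral_lincomb_mult[of p M g "\<lambda>x. u x i" a, OF g u[OF that]] unfolding C_def
    by (simp add: mult.commute inner_p_commute[of _ a])
  obtain X where X: "\<And>y i. i < p \<Longrightarrow> inner_p p (C i) (X y) = y i"
  proof (rule right_inverse_exists[of p C])
    fix a assume "\<And>i. i < p \<Longrightarrow> inner_p p (C i) a = 0"
    thus "\<forall>k<p. a k = 0" using C by (intro inj) auto
  qed blast
  show ?thesis by (rule that[of X]) (use C X in auto)
qed

section \<open>Error propagation to the unseen block\<close>

lemma inner_p_cong: "(\<And>i. i < p \<Longrightarrow> y i = z i) \<Longrightarrow> inner_p p x y = inner_p p x z"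
  unfolding inner_p_def by simp

text \<open>By linearity the left side is the square of an error row paired with
  \<open>\<psi>\<close>, and Cauchy-Schwarz applies. Every application of the error kernel to a
  function is bounded this way.\<close>

lemma pairing_with_lincomb_diff:
  fixes g gh :: "'a \<Rightarrow> nat \<Rightarrow> real"
  assumes g: "\<And>i. i < p \<Longrightarrow> square_integrable M (\<lambda>v. g v i)"
    and gh: "\<And>i. i < p \<Longrightarrow> square_integrable M (\<lambda>v. gh v i)"
    and \<psi>: "square_integrable M \<psi>"
  shows "(inner_p p x (\<lambda>i. \<integral>v. g v i * \<psi> v \<partial>M) - inner_p p y (\<lambda>i. \<integral>v. gh v i * \<psi> v \<partial>M))\<^sup>2
    \<le> (\<integral>v. (inner_p p x (g v) - inner_p p y (gh v))\<^sup>2 \<partial>M) * (\<integral>v. (\<psi> v)\<^sup>2 \<partial>M)"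
proof -
  have sx: "square_integrable M (\<lambda>v. inner_p p x (g v))"
    and sy: "square_integrable M (\<lambda>v. inner_p p y (gh v))"
    using g gh by (auto intro: square_integrable_lincomb(1))
  have "(\<integral>v. (inner_p p x (g v) - inner_p p y (gh v)) * \<psi> v \<partial>M)
      = (\<integral>v. inner_p p x (g v) * \<psi> v \<partial>M) - (\<integral>v. inner_p p y (gh v) * \<psi> v \<partial>M)"
    using square_integrable_mult[OF sx \<psi>] square_integrable_mult[OF sy \<psi>]
    by (simp add: left_diff_distrib)
  also have "\<dots> = inner_p p x (\<lambda>i. \<integral>v. g v i * \<psi> v \<partial>M) - inner_p p y (\<lambda>i. \<integral>v. gh v i * \<psi> v \<partial>M)"
    using integral_lincomb_mult[of p M g \<psi> x, OF g \<psi>] integral_lincomb_mult[of p M gh \<psi> y, OF gh \<psi>] by simp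
  finally show ?thesis
    using integral_Cauchy_Schwarz[OF square_integrable_diff[OF sx sy] \<psi>] by simp
qed

text \<open>For \<open>\<psi>\<close> in the span of \<open>g\<close>, the true kernel maps
  \<open>\<psi>\<close> to \<open>inner_p p (f w) b\<close> and the estimate maps it to
  \<open>inner_p p (fh w) (c a)\<close>. The first image has squared norm at least
  \<open>s * t\<close> times that of \<open>\<psi>\<close> and the difference at most a quarter of
  this, so the estimate retains a quarter.\<close>

lemma perturbed_factor_nondegenerate:
  fixes f fh :: "'w \<Rightarrow> nat \<Rightarrow> real" and g gh :: "'v \<Rightarrow> nat \<Rightarrow> real"
  assumes prob: "prob_space W" "prob_space V"
    and f: "\<And>i. i < p \<Longrightarrow> square_integrable W (\<lambda>w. f w i)"
    and fh: "\<And>i. i < p \<Longrightarrow> square_integrable W (\<lambda>w. fh w i)"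
    and g: "\<And>i. i < p \<Longrightarrow> square_integrable V (\<lambda>v. g v i)"
    and gh: "\<And>i. i < p \<Longrightarrow> square_integrable V (\<lambda>v. gh v i)"
    and s: "s \<ge> 0" "\<And>a. s * inner_p p a a \<le> (\<integral>w. (inner_p p a (f w))\<^sup>2 \<partial>W)"
    and t: "t \<ge> 0" "\<And>a. t * inner_p p a a \<le> (\<integral>v. (inner_p p a (g v))\<^sup>2 \<partial>V)"
    and err: "(\<integral>(w, v). (inner_p p (f w) (g v) - inner_p p (fh w) (gh v))\<^sup>2 \<partial>(W \<Otimes>\<^sub>M V)) \<le> s * t / 4"
  defines "c \<equiv> \<lambda>a i. \<integral>v. gh v i * inner_p p a (g v) \<partial>V"
  shows "s * t / 4 * (\<integral>v. (inner_p p a (g v))\<^sup>2 \<partial>V) \<le> (\<integral>w. (inner_p p (fh w) (c a))\<^sup>2 \<partial>W)"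
proof -
  define \<psi> where "\<psi> v = inner_p p a (g v)" for v
  have \<psi>: "square_integrable V \<psi>"
    unfolding \<psi>_def using g by (intro square_integrable_lincomb(1))
  define n where "n = (\<integral>v. (\<psi> v)\<^sup>2 \<partial>V)"
  define b where "b i = (\<integral>v. g v i * \<psi> v \<partial>V)" for i
  define K where "K w v = inner_p p (f w) (g v) - inner_p p (fh w) (gh v)" for w v
  have K: "square_integrable (W \<Otimes>\<^sub>M V) (\<lambda>(w, v). K w v)"
    using square_integrable_diff[OF square_integrable_pair_inner[of W V p f g, OF prob f g]
        square_integrable_pair_inner[of W V p fh gh, OF prob fh gh]]
    unfolding K_def by (simp add: case_prod_beta')
  have n0: "n \<ge> 0" unfolding n_def by simp
  have ca: "c a i = (\<integral>v. gh v i * \<psi> v \<partial>V)" for i unfolding c_def \<psi>_def by simp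
  have d: "(inner_p p (f w) b - inner_p p (fh w) (c a))\<^sup>2 \<le> (\<integral>v. (K w v)\<^sup>2 \<partial>V) * n" for w
    using pairing_with_lincomb_diff[of p V g gh \<psi> "f w" "fh w", OF g gh \<psi>]
    unfolding K_def n_def b_def ca by simp
  have point: "1/2 * (inner_p p b (f w))\<^sup>2 \<le> (inner_p p (fh w) (c a))\<^sup>2 + (\<integral>v. (K w v)\<^sup>2 \<partial>V) * n" for w
  proof -
    \<comment> \<open>Halving reduces the lower bound to \<open>s * t / 2\<close>, and the error
      then takes away at most \<open>s * t / 4\<close>.\<close>
    have "1/2 * u\<^sup>2 \<le> x\<^sup>2 + (u - x)\<^sup>2" for u x :: real
      using zero_le_power2[of "u - 2 * x"] by (simp add: power2_eq_square algebra_simps)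
    from this[of "inner_p p (f w) b" "inner_p p (fh w) (c a)"] d[of w] show ?thesis
      by (simp add: inner_p_commute[of p b])
  qed
  have i1: "integrable W (\<lambda>w. (inner_p p b (f w))\<^sup>2)"
    using square_integrable_lincomb(1)[of p W f, OF f] unfolding square_integrable_def by blast
  have i2: "integrable W (\<lambda>w. (inner_p p (fh w) (c a))\<^sup>2)"
    using square_integrable_lincomb(2)[of p W fh, OF fh] unfolding square_integrable_def by blast
  note sec = square_integrable_pair_sections[OF prob K]
  have "1/2 * (\<integral>w. (inner_p p b (f w))\<^sup>2 \<partial>W) = (\<integral>w. 1/2 * (inner_p p b (f w))\<^sup>2 \<partial>W)" by simp
  also have "\<dots> \<le> (\<integral>w. (inner_p p (fh w) (c a))\<^sup>2 + (\<integral>v. (K w v)\<^sup>2 \<partial>V) * n \<partial>W)"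
    using i1 i2 sec(1) point by (intro integral_mono) auto
  also have "\<dots> = (\<integral>w. (inner_p p (fh w) (c a))\<^sup>2 \<partial>W) + (\<integral>(w, v). (K w v)\<^sup>2 \<partial>(W \<Otimes>\<^sub>M V)) * n"
    using i2 sec(1,2) by simp
  also have "\<dots> \<le> (\<integral>w. (inner_p p (fh w) (c a))\<^sup>2 \<partial>W) + s * t / 4 * n"
    using err n0 unfolding K_def by (intro add_mono mult_right_mono) auto
  finally have 1: "1/2 * (\<integral>w. (inner_p p b (f w))\<^sup>2 \<partial>W) \<le> (\<integral>w. (inner_p p (fh w) (c a))\<^sup>2 \<partial>W) + s * t / 4 * n" .
  \<comment> \<open>\<open>b\<close> is the Gram image of \<open>a\<close>: the factor
    \<open>t\<close> comes from \<open>g\<close>, and the factor \<open>s\<close> below from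
    \<open>f\<close>.\<close>
  have "t * n \<le> inner_p p b b"
    using gram_square_ge[of p V g t a, OF g t(1) t(2)] unfolding n_def b_def \<psi>_def by simp
  hence "s * (t * n) \<le> s * inner_p p b b" using s(1) by (rule mult_left_mono)
  also note s(2)[of b]
  finally show ?thesis using 1 unfolding n_def \<psi>_def by simp
qed

text \<open>Each point \<open>(w, v)\<close> gets its own kernels \<open>L\<close> and
  \<open>R\<close>, which turns the block identity into a pointwise bound by products of a function
  of \<open>w\<close> and a function of \<open>v\<close>. With \<open>A = m / (s * t)\<close>,
  integration gives the seen errors the weights \<open>27 A\<close> for (2,1), \<open>3 A\<close>
  for (1,2) and 27 times the square of \<open>A\<close> for (1,1); \<open>A \<ge> 1\<close> yields
  the common constant.\<close>

lemma completion_error_bound: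
  fixes f fh :: "'w \<Rightarrow> nat \<Rightarrow> real" and g gh :: "'v \<Rightarrow> nat \<Rightarrow> real"
  assumes prob: "\<And>W. W \<in> {W1, W2} \<Longrightarrow> prob_space W" "\<And>V. V \<in> {V1, V2} \<Longrightarrow> prob_space V"
    and f: "\<And>W i. W \<in> {W1, W2} \<Longrightarrow> i < p \<Longrightarrow> square_integrable W (\<lambda>w. f w i)"
    and fh: "\<And>W i. W \<in> {W1, W2} \<Longrightarrow> i < p \<Longrightarrow> square_integrable W (\<lambda>w. fh w i)"
    and g: "\<And>V i. V \<in> {V1, V2} \<Longrightarrow> i < p \<Longrightarrow> square_integrable V (\<lambda>v. g v i)"
    and gh: "\<And>V i. V \<in> {V1, V2} \<Longrightarrow> i < p \<Longrightarrow> square_integrable V (\<lambda>v. gh v i)"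
    and s: "s > 0" "\<And>a. s * inner_p p a a \<le> (\<integral>w. (inner_p p a (f w))\<^sup>2 \<partial>W1)"
    and t: "t > 0" "\<And>a. t * inner_p p a a \<le> (\<integral>v. (inner_p p a (g v))\<^sup>2 \<partial>V1)"
    and p: "p \<ge> 1"
    and m: "\<And>W V. W \<in> {W1, W2} \<Longrightarrow> V \<in> {V1, V2} \<Longrightarrow> (\<integral>(w, v). (inner_p p (f w) (g v))\<^sup>2 \<partial>(W \<Otimes>\<^sub>M V)) \<le> m"
  defines "E \<equiv> \<lambda>W V. \<integral>(w, v). (inner_p p (f w) (g v) - inner_p p (fh w) (gh v))\<^sup>2 \<partial>(W \<Otimes>\<^sub>M V)"
  assumes err: "E W1 V1 \<le> s * t / 4" "E W1 V2 \<le> s * t / 4"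
  shows "E W2 V2 \<le> 27 * (m / (s * t))\<^sup>2 * (E W1 V1 + E W1 V2 + E W2 V1)"
proof -
  have st: "s * t > 0" using s(1) t(1) by simp
  define h where "h w v = inner_p p (f w) (g v)" for w v
  define hh where "hh w v = inner_p p (fh w) (gh v)" for w v
  define K where "K w v = h w v - hh w v" for w v
  have E: "E W V = (\<integral>(w, v). (K w v)\<^sup>2 \<partial>(W \<Otimes>\<^sub>M V))" for W V
    unfolding E_def K_def h_def hh_def ..
  have E0: "E W V \<ge> 0" for W V unfolding E by (intro Bochner_Integration.integral_nonneg) auto
  have h_sq: "square_integrable (W \<Otimes>\<^sub>M V) (\<lambda>(w, v). h w v)" if "W \<in> {W1, W2}" "V \<in> {V1, V2}" for W V
    unfolding h_def using that prob f g by (intro square_integrable_pair_inner) auto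
  have hh_sq: "square_integrable (W \<Otimes>\<^sub>M V) (\<lambda>(w, v). hh w v)" if "W \<in> {W1, W2}" "V \<in> {V1, V2}" for W V
    unfolding hh_def using that prob fh gh by (intro square_integrable_pair_inner) auto
  have K_sq: "square_integrable (W \<Otimes>\<^sub>M V) (\<lambda>(w, v). K w v)" if "W \<in> {W1, W2}" "V \<in> {V1, V2}" for W V
    using square_integrable_diff[OF h_sq[OF that] hh_sq[OF that]] unfolding K_def by (simp add: case_prod_beta')
  note h_sec = square_integrable_pair_sections[OF prob(1) prob(2) h_sq]
  note hh_sec = square_integrable_pair_sections[OF prob(1) prob(2) hh_sq]
  note K_sec = square_integrable_pair_sections[OF prob(1) prob(2) K_sq]

  define c where "c a i = (\<integral>v. gh v i * inner_p p a (g v) \<partial>V1)" for a i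
  have nondeg: "s * t / 4 * (\<integral>v. (inner_p p a (g v))\<^sup>2 \<partial>V1) \<le> (\<integral>w. (inner_p p (fh w) (c a))\<^sup>2 \<partial>W1)" for a
    unfolding c_def[abs_def]
    by (rule perturbed_factor_nondegenerate[of W1 V1 p f fh g gh s t])
       (use prob f fh g gh s t err(1) in \<open>auto simp: E_def\<close>)
  \<comment> \<open>\<open>X\<close> inverts the Gram matrix of \<open>f\<close> under
    \<open>W1\<close>, injective because \<open>s > 0\<close>.\<close>
  obtain X where X: "\<And>y i. i < p \<Longrightarrow> (\<integral>w. f w i * inner_p p (X y) (f w) \<partial>W1) = y i"
  proof (rule dual_lincomb_exists[of p W1 f f])
    fix a assume a: "\<And>i. i < p \<Longrightarrow> (\<integral>w. f w i * inner_p p a (f w) \<partial>W1) = 0"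
    have "s * (\<integral>w. (inner_p p a (f w))\<^sup>2 \<partial>W1) \<le> 0"
      using gram_square_ge[of p W1 f s a, OF f _ s(2)] s(1) a by (simp add: inner_p_def)
    hence "(\<integral>w. (inner_p p a (f w))\<^sup>2 \<partial>W1) \<le> 0" using s(1) by (simp add: mult_le_0_iff)
    hence "s * inner_p p a a \<le> 0" using s(2)[of a] by linarith
    hence "inner_p p a a = 0" using s(1) inner_p_self_nonneg[of p a] by (simp add: mult_le_0_iff)
    thus "\<forall>k<p. a k = 0" by (simp add: inner_p_self_eq_0)
  qed (use f in auto)
  \<comment> \<open>If all pairings with \<open>gh\<close> vanish, the estimated kernel annihilates
    \<open>inner_p p a (g v)\<close>, and \<open>nondeg\<close> forces that function to have norm
    zero.\<close>
  obtain Y where Y: "\<And>y i. i < p \<Longrightarrow> (\<integral>v. gh v i * inner_p p (Y y) (g v) \<partial>V1) = y i"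
  proof (rule dual_lincomb_exists[of p V1 gh g])
    fix a assume a: "\<And>i. i < p \<Longrightarrow> (\<integral>v. gh v i * inner_p p a (g v) \<partial>V1) = 0"
    have "inner_p p (fh w) (c a) = 0" for w unfolding inner_p_def c_def using a by (simp add: inner_p_def)
    hence "s * t / 4 * (\<integral>v. (inner_p p a (g v))\<^sup>2 \<partial>V1) \<le> 0" using nondeg[of a] by simp
    hence "(\<integral>v. (inner_p p a (g v))\<^sup>2 \<partial>V1) \<le> 0" using s(1) t(1) by (simp add: mult_le_0_iff)
    hence "t * inner_p p a a \<le> 0" using t(2)[of a] by linarith
    hence "inner_p p a a = 0" using t(1) inner_p_self_nonneg[of p a] by (simp add: mult_le_0_iff)
    thus "\<forall>k<p. a k = 0" by (simp add: inner_p_self_eq_0)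
  qed (use g gh in auto)

  \<comment> \<open>\<open>\<alpha>\<close> and \<open>\<beta>\<close> are squared norms of error
    rows and columns. \<open>\<mu>\<close> and \<open>\<nu>\<close> will bound the squared norms of
    \<open>L\<close> and \<open>R\<close>; the factor 4 in \<open>\<nu>\<close> inverts the quarter
    in \<open>nondeg\<close>.\<close>
  define \<alpha> where "\<alpha> w = (\<integral>v. (K w v)\<^sup>2 \<partial>V1)" for w
  define \<beta> where "\<beta> v = (\<integral>w. (K w v)\<^sup>2 \<partial>W1)" for v
  define \<mu> where "\<mu> w = (\<integral>v. (h w v)\<^sup>2 \<partial>V1) / (s * t)" for w
  define \<nu> where "\<nu> v = 4 * (\<integral>w. (hh w v)\<^sup>2 \<partial>W1) / (s * t)" for v
  have \<alpha>: "integrable W \<alpha>" "(\<integral>w. \<alpha> w \<partial>W) = E W V1" if "W \<in> {W1, W2}" for W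
    using K_sec(1,2)[OF that _ that, of V1] unfolding \<alpha>_def[abs_def] E by auto
  have \<beta>: "integrable V2 \<beta>" "(\<integral>v. \<beta> v \<partial>V2) = E W1 V2"
    using K_sec(3,4)[of W1 V2] unfolding \<beta>_def[abs_def] E by auto
  have \<mu>: "integrable W2 \<mu>" "(\<integral>w. \<mu> w \<partial>W2) \<le> m / (s * t)"
    using h_sec(1,2)[of W2 V1] m[of W2 V1] st unfolding \<mu>_def[abs_def] h_def
    by (auto simp: divide_right_mono)
  \<comment> \<open>The weights 3/2 and 3 come from the square of \<open>3 h - 2 hh\<close>. Once
    \<open>s * t \<le> m\<close> is known, four times this bound is at most
    \<open>6 m + 3 m = 9 m\<close>.\<close>
  have hh_bound: "(\<integral>(w, v). (hh w v)\<^sup>2 \<partial>(W1 \<Otimes>\<^sub>M V2)) \<le> 3/2 * m + 3 * (s * t / 4)"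
  proof -
    let ?N = "W1 \<Otimes>\<^sub>M V2"
    have i: "integrable ?N (\<lambda>(w, v). (hh w v)\<^sup>2)" "integrable ?N (\<lambda>(w, v). (h w v)\<^sup>2)"
        "integrable ?N (\<lambda>(w, v). (K w v)\<^sup>2)"
      using h_sq[of W1 V2] hh_sq[of W1 V2] K_sq[of W1 V2]
      by (auto simp: square_integrable_def case_prod_beta')
    have pw: "(hh w v)\<^sup>2 \<le> 3/2 * (h w v)\<^sup>2 + 3 * (K w v)\<^sup>2" for w v
      using zero_le_power2[of "3 * h w v - 2 * hh w v"]
      unfolding K_def by (simp add: power2_eq_square algebra_simps)
    have "(\<integral>(w, v). (hh w v)\<^sup>2 \<partial>?N) \<le> (\<integral>x. 3/2 * (case x of (w, v) \<Rightarrow> (h w v)\<^sup>2) + 3 * (case x of (w, v) \<Rightarrow> (K w v)\<^sup>2) \<partial>?N)"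
      using i pw by (intro integral_mono) auto
    also have "\<dots> = 3/2 * (\<integral>(w, v). (h w v)\<^sup>2 \<partial>?N) + 3 * E W1 V2"
      using i unfolding E by simp
    also have "\<dots> \<le> 3/2 * m + 3 * (s * t / 4)"
      using m[of W1 V2] err(2) unfolding h_def by (intro add_mono mult_left_mono) auto
    finally show ?thesis .
  qed
  \<comment> \<open>On the block (1,1), \<open>t\<close> bounds the rows of \<open>h\<close> below
    by the squared length of \<open>f w\<close>, hence by its coordinate 0, and \<open>s\<close>
    bounds the mean square of that coordinate; \<open>p \<ge> 1\<close> makes it exist.\<close>
  have st_le: "s * t \<le> m"
  proof -
    define e :: "nat \<Rightarrow> real" where "e = (\<lambda>i. if i = 0 then 1 else 0)"
    have e: "inner_p p e y = y 0" for y
      using p unfolding inner_p_def e_def by (simp add: if_distrib if_distribR sum.delta cong: if_cong)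
    have "t * (f w 0)\<^sup>2 \<le> (\<integral>v. (h w v)\<^sup>2 \<partial>V1)" for w
    proof -
      have "(f w 0)\<^sup>2 \<le> inner_p p (f w) (f w)"
        unfolding inner_p_def power2_eq_square using p by (intro member_le_sum[of 0]) auto
      hence "t * (f w 0)\<^sup>2 \<le> t * inner_p p (f w) (f w)" using t(1) by (intro mult_left_mono) auto
      also note t(2)[of "f w"]
      finally show ?thesis unfolding h_def .
    qed
    hence "(\<integral>w. t * (f w 0)\<^sup>2 \<partial>W1) \<le> (\<integral>w. \<integral>v. (h w v)\<^sup>2 \<partial>V1 \<partial>W1)"
      using f[of W1 0] h_sec(1)[of W1 V1] p by (intro integral_mono) (auto simp: square_integrable_def)
    also have "\<dots> \<le> m" using h_sec(2)[of W1 V1] m[of W1 V1] unfolding h_def by auto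
    finally have "t * (\<integral>w. (f w 0)\<^sup>2 \<partial>W1) \<le> m" by simp
    moreover have "s \<le> (\<integral>w. (f w 0)\<^sup>2 \<partial>W1)" using s(2)[of e] e by (simp add: e_def)
    hence "t * s \<le> t * (\<integral>w. (f w 0)\<^sup>2 \<partial>W1)" using t(1) by (intro mult_left_mono) auto
    ultimately show ?thesis by (simp add: mult.commute)
  qed
  have \<nu>: "integrable V2 \<nu>" "(\<integral>v. \<nu> v \<partial>V2) \<le> 9 * (m / (s * t))"
  proof -
    show "integrable V2 \<nu>" using hh_sec(3)[of W1 V2] unfolding \<nu>_def[abs_def] by auto
    have "(\<integral>v. \<nu> v \<partial>V2) = 4 * (\<integral>(w, v). (hh w v)\<^sup>2 \<partial>(W1 \<Otimes>\<^sub>M V2)) / (s * t)"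
      using hh_sec(4)[of W1 V2] unfolding \<nu>_def by simp
    also have "\<dots> \<le> 9 * m / (s * t)" using hh_bound st_le st by (intro divide_right_mono) auto
    finally show "(\<integral>v. \<nu> v \<partial>V2) \<le> 9 * (m / (s * t))" by simp
  qed

  \<comment> \<open>\<open>L\<close> and \<open>R\<close> are kernels with \<open>L h = h(w, \<cdot>)\<close> and \<open>hh R = hh(\<cdot>, v)\<close>, so that
    \<open>K = K R + L K - L K R\<close>; the three terms are \<open>x w\<close>, \<open>y\<close> and \<open>z\<close> below.\<close>
  have point: "(K w v)\<^sup>2 \<le> 3 * (\<alpha> w * \<nu> v) + 3 * (\<mu> w * \<beta> v) + 3 * E W1 V1 * (\<mu> w * \<nu> v)" for w v
  proof -
    define L where "L w' = inner_p p (X (f w)) (f w')" for w'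
    define R where "R v' = inner_p p (Y (gh v)) (g v')" for v'
    have L: "square_integrable W1 L" unfolding L_def using f by (intro square_integrable_lincomb(1)) auto
    have R: "square_integrable V1 R" unfolding R_def using g by (intro square_integrable_lincomb(1)) auto
    have fL: "(\<integral>w'. f w' i * L w' \<partial>W1) = f w i" if "i < p" for i using X[OF that] unfolding L_def .
    have ghR: "(\<integral>v'. gh v' i * R v' \<partial>V1) = gh v i" if "i < p" for i using Y[OF that] unfolding R_def .
    define l where "l = (\<integral>w'. (L w')\<^sup>2 \<partial>W1)"
    define n where "n = (\<integral>v'. (R v')\<^sup>2 \<partial>V1)"
    have l0: "l \<ge> 0" and n0: "n \<ge> 0" unfolding l_def n_def by simp_all
    \<comment> \<open>The Gram image of \<open>X (f w)\<close> is \<open>f w\<close>, so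
      \<open>s * l\<close> is at most its squared length, which \<open>t\<close> compares with the
      row \<open>h w\<close>.\<close>
    have l: "l \<le> \<mu> w"
    proof -
      have "s * l \<le> inner_p p (f w) (f w)"
        using gram_square_ge[of p W1 f s "X (f w)", OF f _ s(2)] s(1) fL
        unfolding l_def L_def[symmetric] by (simp add: inner_p_def)
      hence "t * (s * l) \<le> t * inner_p p (f w) (f w)" using t(1) by (intro mult_left_mono) auto
      also note t(2)[of "f w"]
      finally show ?thesis using st unfolding \<mu>_def h_def by (simp add: field_simps)
    qed
    \<comment> \<open>By the choice of \<open>Y\<close>, the estimated kernel maps \<open>R\<close>
      to its own column at \<open>v\<close>, so \<open>nondeg\<close> bounds \<open>R\<close> by
      that column.\<close>
    have n: "n \<le> \<nu> v"
    proof -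
      have "c (Y (gh v)) i = gh v i" if "i < p" for i unfolding c_def using ghR[OF that] unfolding R_def .
      hence "inner_p p (fh w') (c (Y (gh v))) = hh w' v" for w'
        unfolding hh_def by (intro inner_p_cong)
      thus ?thesis using nondeg[of "Y (gh v)"] st unfolding \<nu>_def n_def R_def by (simp add: field_simps)
    qed
    define q where "q i = (\<integral>v'. g v' i * R v' \<partial>V1)" for i
    define r where "r i = (\<integral>w'. fh w' i * L w' \<partial>W1)" for i
    define x where "x w' = inner_p p (f w') q - inner_p p (fh w') (gh v)" for w'
    define y where "y = inner_p p (g v) (f w) - inner_p p (gh v) r"
    define z where "z = inner_p p q (f w) - inner_p p (gh v) r"
    \<comment> \<open>Proved for every row \<open>w'\<close>, since \<open>x\<close> is used at
      \<open>w\<close> and also integrated over \<open>W1\<close> to bound \<open>z\<close>.\<close>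
    have x2: "(x w')\<^sup>2 \<le> \<alpha> w' * n" for w'
    proof -
      have "inner_p p (fh w') (\<lambda>i. \<integral>v'. gh v' i * R v' \<partial>V1) = inner_p p (fh w') (gh v)"
        by (intro inner_p_cong ghR)
      thus ?thesis using pairing_with_lincomb_diff[of p V1 g gh R "f w'" "fh w'", OF g gh R]
        unfolding x_def \<alpha>_def K_def h_def hh_def n_def q_def by simp
    qed
    have fL': "inner_p p u (\<lambda>i. \<integral>w'. f w' i * L w' \<partial>W1) = inner_p p u (f w)" for u
      by (intro inner_p_cong fL)
    have y2: "y\<^sup>2 \<le> \<beta> v * l"
      using pairing_with_lincomb_diff[of p W1 f fh L "g v" "gh v", OF f fh L] fL'
      unfolding y_def \<beta>_def K_def h_def hh_def l_def r_def by (simp add: inner_p_commute[of p "g v"] inner_p_commute[of p "gh v" "fh _"])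
    have ix: "integrable W1 (\<lambda>w'. (x w')\<^sup>2)"
    proof -
      have "square_integrable W1 x" unfolding x_def
        using f fh by (intro square_integrable_diff square_integrable_lincomb(2)) auto
      thus ?thesis by (simp add: square_integrable_def)
    qed
    \<comment> \<open>\<open>z\<close> is \<open>L\<close> applied to the function \<open>x\<close>,
      so Cauchy-Schwarz over \<open>W1\<close> separates the two.\<close>
    have "z\<^sup>2 \<le> (\<integral>w'. (x w')\<^sup>2 \<partial>W1) * l"
      using pairing_with_lincomb_diff[of p W1 f fh L q "gh v", OF f fh L] fL'
      unfolding z_def x_def l_def r_def by (simp add: inner_p_commute[of p q] inner_p_commute[of p "gh v" "fh _"])
    also have "(\<integral>w'. (x w')\<^sup>2 \<partial>W1) \<le> (\<integral>w'. \<alpha> w' * n \<partial>W1)"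
      using ix \<alpha>(1)[of W1] x2 by (intro integral_mono) auto
    also have "\<dots> = E W1 V1 * n" using \<alpha>(2)[of W1] by simp
    finally have z2: "z\<^sup>2 \<le> E W1 V1 * n * l" using l0 by (simp add: mult_right_mono)
    \<comment> \<open>The terms containing \<open>q\<close> and \<open>r\<close> cancel.\<close>
    have "K w v = x w + y - z"
      unfolding K_def h_def hh_def x_def y_def z_def
      by (simp add: inner_p_commute[of p q] inner_p_commute[of p "g v"])
    moreover have "(x' + y' - z')\<^sup>2 \<le> 3 * (x'\<^sup>2 + y'\<^sup>2 + z'\<^sup>2)" for x' y' z' :: real
      using zero_le_power2[of "x' - y'"] zero_le_power2[of "x' + z'"] zero_le_power2[of "y' + z'"]
      by (simp add: power2_eq_square algebra_simps)
    ultimately have "(K w v)\<^sup>2 \<le> 3 * ((x w)\<^sup>2 + y\<^sup>2 + z\<^sup>2)" by simp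
    moreover have "(x w)\<^sup>2 \<le> \<alpha> w * \<nu> v"
      using x2[of w] n by (rule order_trans[OF _ mult_left_mono]) (simp add: \<alpha>_def)
    moreover have "y\<^sup>2 \<le> \<mu> w * \<beta> v"
      using y2 mult_left_mono[OF l, of "\<beta> v"] by (simp add: \<beta>_def mult.commute)
    moreover have "z\<^sup>2 \<le> E W1 V1 * (\<mu> w * \<nu> v)"
    proof -
      have "l * n \<le> \<mu> w * \<nu> v" using l n l0 n0 by (intro mult_mono) auto
      hence "E W1 V1 * (l * n) \<le> E W1 V1 * (\<mu> w * \<nu> v)" using E0 by (intro mult_left_mono)
      thus ?thesis using z2 by (simp add: mult_ac)
    qed
    ultimately show ?thesis by argo
  qed

  have P: "prob_space W2" "prob_space V2" using prob by auto
  have \<alpha>2: "integrable W2 \<alpha>" using \<alpha>(1) by simp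
  note prods = integrable_pair_mult[OF P \<alpha>2 \<nu>(1)] integrable_pair_mult[OF P \<mu>(1) \<beta>(1)]
    integrable_pair_mult[OF P \<mu>(1) \<nu>(1)]
  let ?N = "W2 \<Otimes>\<^sub>M V2"
  define A where "A = m / (s * t)"
  have A1: "A \<ge> 1" unfolding A_def using st st_le by simp
  hence AA: "A \<le> A\<^sup>2" by (simp add: power2_eq_square)
  \<comment> \<open>Each summand is a product of a function of \<open>w\<close> and a function of
    \<open>v\<close>, so its integral over the product factorises.\<close>
  have "E W2 V2 \<le> (\<integral>x. 3 * (case x of (w, v) \<Rightarrow> \<alpha> w * \<nu> v) + 3 * (case x of (w, v) \<Rightarrow> \<mu> w * \<beta> v)
      + 3 * E W1 V1 * (case x of (w, v) \<Rightarrow> \<mu> w * \<nu> v) \<partial>?N)"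
    unfolding E[of W2 V2] using K_sq[of W2 V2] prods point
    by (intro integral_mono) (auto simp: square_integrable_def case_prod_beta')
  also have "\<dots> = 3 * (E W2 V1 * (\<integral>v. \<nu> v \<partial>V2)) + 3 * ((\<integral>w. \<mu> w \<partial>W2) * E W1 V2)
      + 3 * E W1 V1 * ((\<integral>w. \<mu> w \<partial>W2) * (\<integral>v. \<nu> v \<partial>V2))"
    using prods \<alpha>(2)[of W2] \<beta>(2) by simp
  also have "\<dots> \<le> 3 * (E W2 V1 * (9 * A)) + 3 * (A * E W1 V2) + 3 * E W1 V1 * (A * (9 * A))"
    using \<mu>(2) \<nu>(2) E0 A1 unfolding A_def[symmetric]
    by (intro add_mono mult_left_mono mult_right_mono mult_mono Bochner_Integration.integral_nonneg)
       (auto simp: \<nu>_def intro!: divide_nonneg_nonneg less_imp_le[OF st])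
  also have "\<dots> \<le> 27 * A\<^sup>2 * (E W1 V1 + E W1 V2 + E W2 V1)"
    using mult_right_mono[OF AA E0[of W2 V1]] mult_right_mono[OF AA E0[of W1 V2]]
      mult_nonneg_nonneg[OF _ E0[of W1 V2], of "A\<^sup>2"]
    by (simp add: algebra_simps power2_eq_square)
  finally show ?thesis unfolding A_def .
qed

section \<open>From the block errors to the risks under D and D'\<close>

theorem mainTheorem4:
  fixes p :: nat and \<kappa> Mstar :: real
    and D D' :: "('w \<times> 'v) measure"
    and DW1 DW2 :: "'w measure" and DV1 DV2 :: "'v measure"
    and fstar fhat :: "'w \<Rightarrow> nat \<Rightarrow> real" and gstar ghat :: "'v \<Rightarrow> nat \<Rightarrow> real"
  defines "hstar \<equiv> \<lambda>(w, v). inner_p p (fstar w) (gstar v)"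
      and "hhat \<equiv> \<lambda>(w, v). inner_p p (fhat w) (ghat v)"
      and "sigstar2 \<equiv> sigma p (second_moment p DW1 fstar) * sigma p (second_moment p DV1 gstar)"
  assumes D: "prob_space D" and D': "prob_space D'"
    and sets_D: "sets D = sets (DW1 \<Otimes>\<^sub>M DV1)" and sets_D': "sets D' = sets D"
    and comb: "comb_dens_le \<kappa> D' D DW1 DW2 DV1 DV2"
    and p: "p \<ge> 1"
    and meas_f: "\<And>i. i < p \<Longrightarrow> (\<lambda>w. fstar w i) \<in> borel_measurable DW1 \<and> (\<lambda>w. fhat w i) \<in> borel_measurable DW1"
    and meas_g: "\<And>i. i < p \<Longrightarrow> (\<lambda>v. gstar v i) \<in> borel_measurable DV1 \<and> (\<lambda>v. ghat v i) \<in> borel_measurable DV1"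
    and int_f: "\<And>i M. i < p \<Longrightarrow> M \<in> {DW1, DW2} \<Longrightarrow>
                  integrable M (\<lambda>w. (fstar w i)\<^sup>2) \<and> integrable M (\<lambda>w. (fhat w i)\<^sup>2)"
    and int_g: "\<And>i M. i < p \<Longrightarrow> M \<in> {DV1, DV2} \<Longrightarrow>
                  integrable M (\<lambda>v. (gstar v i)\<^sup>2) \<and> integrable M (\<lambda>v. (ghat v i)\<^sup>2)"
    and int_D: "integrable D (\<lambda>x. (hstar x - hhat x)\<^sup>2)"
    and int_D': "integrable D' (\<lambda>x. (hstar x - hhat x)\<^sup>2)"
    and sig_pos: "sigstar2 > 0"
    and Mbound: "\<And>MW MV. MW \<in> {DW1, DW2} \<Longrightarrow> MV \<in> {DV1, DV2} \<Longrightarrow>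
                   (\<integral>x. \<bar>hstar x\<bar>\<^sup>2 \<partial>(MW \<Otimes>\<^sub>M MV)) \<le> Mstar\<^sup>2"
    and small: "risk hstar hhat D \<le> sigstar2 / (4 * \<kappa>)"
  shows "risk hstar hhat D' \<le> risk hstar hhat D * \<kappa>\<^sup>2 * (1 + 64 * Mstar ^ 4 / sigstar2\<^sup>2)"
proof -
  have P: "prob_space DW1" "prob_space DW2" "prob_space DV1" "prob_space DV2"
    and sets_W: "sets DW2 = sets DW1" and sets_V: "sets DV2 = sets DV1"
    using comb unfolding comb_dens_le_def by auto
  have lower: "measure (DW1 \<Otimes>\<^sub>M DV1) A + measure (DW1 \<Otimes>\<^sub>M DV2) A + measure (DW2 \<Otimes>\<^sub>M DV1) A
      \<le> \<kappa> * measure D A" if "A \<in> sets D" for A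
    using comb that unfolding comb_dens_le_def by blast
  have upper: "measure D' A \<le> \<kappa> * (measure (DW1 \<Otimes>\<^sub>M DV1) A + measure (DW1 \<Otimes>\<^sub>M DV2) A
      + measure (DW2 \<Otimes>\<^sub>M DV1) A + measure (DW2 \<Otimes>\<^sub>M DV2) A)" if "A \<in> sets D" for A
    using comb that sets_D' unfolding comb_dens_le_def by blast
  \<comment> \<open>The sign is read off from the domination on the whole space.\<close>
  have \<kappa>: "\<kappa> \<ge> 0"
  proof -
    have "0 \<le> measure (DW1 \<Otimes>\<^sub>M DV1) (space D) + measure (DW1 \<Otimes>\<^sub>M DV2) (space D) + measure (DW2 \<Otimes>\<^sub>M DV1) (space D)"
      by simp
    also have "\<dots> \<le> \<kappa> * measure D (space D)" by (rule lower) simp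
    finally show ?thesis using prob_space.prob_space[OF D] by simp
  qed
  have prob_W: "prob_space M" and sets_W': "sets M = sets DW1" if "M \<in> {DW1, DW2}" for M
    using that P sets_W by auto
  have prob_V: "prob_space M" and sets_V': "sets M = sets DV1" if "M \<in> {DV1, DV2}" for M
    using that P sets_V by auto
  have f: "square_integrable M (\<lambda>w. fstar w i)" "square_integrable M (\<lambda>w. fhat w i)"
    if "M \<in> {DW1, DW2}" "i < p" for M i
    using int_f[OF that(2,1)] meas_f[OF that(2)] measurable_cong_sets[OF sets_W'[OF that(1)] refl, of borel]
    unfolding square_integrable_def by auto
  have g: "square_integrable M (\<lambda>w. gstar w i)" "square_integrable M (\<lambda>w. ghat w i)"
    if "M \<in> {DV1, DV2}" "i < p" for M i
    using int_g[OF that(2,1)] meas_g[OF that(2)] measurable_cong_sets[OF sets_V'[OF that(1)] refl, of borel]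
    unfolding square_integrable_def by auto
  define s where "s = sigma p (second_moment p DW1 fstar)"
  define t where "t = sigma p (second_moment p DV1 gstar)"
  have s: "s \<ge> 0" "\<And>a. s * inner_p p a a \<le> (\<integral>w. (inner_p p a (fstar w))\<^sup>2 \<partial>DW1)"
    unfolding s_def using sigma_second_moment[of p DW1 fstar] f p by auto
  have t: "t \<ge> 0" "\<And>a. t * inner_p p a a \<le> (\<integral>v. (inner_p p a (gstar v))\<^sup>2 \<partial>DV1)"
    unfolding t_def using sigma_second_moment[of p DV1 gstar] g p by auto
  have sig: "sigstar2 = s * t" unfolding sigstar2_def s_def t_def ..
  \<comment> \<open>Positivity of the product gives positivity of both factors because neither is
    negative.\<close>
  have s0: "s > 0" and t0: "t > 0" using sig_pos s(1) t(1) unfolding sig by (auto simp: zero_less_mult_iff)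
  define u where "u x = (hstar x - hhat x)\<^sup>2" for x
  define E where "E W V = (\<integral>x. u x \<partial>(W \<Otimes>\<^sub>M V))" for W V
  have u_int: "integrable (W \<Otimes>\<^sub>M V) u" if "W \<in> {DW1, DW2}" "V \<in> {DV1, DV2}" for W V
  proof -
    have "square_integrable (W \<Otimes>\<^sub>M V) hstar" "square_integrable (W \<Otimes>\<^sub>M V) hhat"
      unfolding hstar_def hhat_def using f g prob_W prob_V that
      by (auto intro!: square_integrable_pair_inner)
    from square_integrable_diff[OF this] show ?thesis
      unfolding square_integrable_def u_def by blast
  qed
  have sets_pair: "sets (W \<Otimes>\<^sub>M V) = sets D" if "W \<in> {DW1, DW2}" "V \<in> {DV1, DV2}" for W V
    using sets_pair_measure_cong[OF sets_W'[OF that(1)] sets_V'[OF that(2)]] sets_D by simp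
  have fin: "finite_measure (W \<Otimes>\<^sub>M V)" if "W \<in> {DW1, DW2}" "V \<in> {DV1, DV2}" for W V
  proof -
    interpret W: prob_space W using prob_W that by blast
    interpret V: prob_space V using prob_V that by blast
    interpret pair_prob_space W V ..
    show ?thesis by unfold_locales
  qed
  have uD: "integrable D u" "integrable D' u" using int_D int_D' unfolding u_def by auto
  have fD: "finite_measure D" "finite_measure D'" using D D' by (auto simp: prob_space_def)
  have R: "risk hstar hhat D = (\<integral>x. u x \<partial>D)" "risk hstar hhat D' = (\<integral>x. u x \<partial>D')"
    unfolding risk_def u_def by auto
  \<comment> \<open>The unseen block comes last, so the seen blocks are the indices below 3 and all
    blocks those below 4.\<close>
  define T where "T = [DW1 \<Otimes>\<^sub>M DV1, DW1 \<Otimes>\<^sub>M DV2, DW2 \<Otimes>\<^sub>M DV1, DW2 \<Otimes>\<^sub>M DV2]"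
  have T: "finite_measure (T ! i)" "sets (T ! i) = sets D" "integrable (T ! i) u" if "i < 4" for i
  proof -
    have "i \<in> {0, 1, 2, 3}" using that by auto
    thus "finite_measure (T ! i)" "sets (T ! i) = sets D" "integrable (T ! i) u"
      unfolding T_def using fin sets_pair u_int by auto
  qed
  have u: "u \<in> borel_measurable D" "\<And>x. u x \<ge> 0" using uD unfolding u_def by auto
  have T3: "(\<Sum>i<3. \<phi> (T ! i)) = \<phi> (DW1 \<Otimes>\<^sub>M DV1) + \<phi> (DW1 \<Otimes>\<^sub>M DV2) + \<phi> (DW2 \<Otimes>\<^sub>M DV1)"
    for \<phi> :: "_ \<Rightarrow> real" unfolding T_def by (simp add: eval_nat_numeral)
  have T4: "(\<Sum>i<4. \<phi> (T ! i)) = \<phi> (DW1 \<Otimes>\<^sub>M DV1) + \<phi> (DW1 \<Otimes>\<^sub>M DV2) + \<phi> (DW2 \<Otimes>\<^sub>M DV1) + \<phi> (DW2 \<Otimes>\<^sub>M DV2)"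
    for \<phi> :: "_ \<Rightarrow> real" unfolding T_def by (simp add: eval_nat_numeral)
  \<comment> \<open>The singleton index set \<open>{()}\<close> presents the single measure
    \<open>D\<close> as a family.\<close>
  have "(\<Sum>i<3. \<integral>x. u x \<partial>(T ! i)) \<le> \<kappa> * (\<Sum>j\<in>{()}. \<integral>x. u x \<partial>D)"
    using lower T \<kappa> fD uD u
    by (intro integral_sum_measures_mono[where L = D]) (auto simp: T3[where \<phi> = "\<lambda>M. measure M _"])
  hence lowerE: "E DW1 DV1 + E DW1 DV2 + E DW2 DV1 \<le> \<kappa> * risk hstar hhat D"
    unfolding E_def R T3[where \<phi> = "\<lambda>M. integral\<^sup>L M _"] by simp
  have "(\<Sum>j\<in>{()}. \<integral>x. u x \<partial>D') \<le> \<kappa> * (\<Sum>i<4. \<integral>x. u x \<partial>(T ! i))"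
    using upper T \<kappa> fD uD u sets_D'
    by (intro integral_sum_measures_mono[where L = D]) (auto simp: T4[where \<phi> = "\<lambda>M. measure M _"])
  hence upperE: "risk hstar hhat D' \<le> \<kappa> * (E DW1 DV1 + E DW1 DV2 + E DW2 DV1 + E DW2 DV2)"
    unfolding E_def R T4[where \<phi> = "\<lambda>M. integral\<^sup>L M _"] by simp
  have E0: "E W V \<ge> 0" for W V unfolding E_def u_def by simp
  have "\<kappa> * risk hstar hhat D \<le> \<kappa> * (sigstar2 / (4 * \<kappa>))" using small \<kappa> by (rule mult_left_mono)
  \<comment> \<open>For \<open>\<kappa> = 0\<close> the left side is 0; otherwise
    \<open>\<kappa>\<close> cancels.\<close>
  also have "\<dots> \<le> s * t / 4" using s0 t0 unfolding sig by (cases "\<kappa> = 0") auto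
  \<comment> \<open>The three errors are nonnegative, so each is at most \<open>s * t / 4\<close>,
    as the completion bound requires.\<close>
  finally have small': "E DW1 DV1 + E DW1 DV2 + E DW2 DV1 \<le> s * t / 4" using lowerE by linarith
  have EE: "(\<integral>(w, v). (inner_p p (fstar w) (gstar v) - inner_p p (fhat w) (ghat v))\<^sup>2 \<partial>(W \<Otimes>\<^sub>M V)) = E W V" for W V
    unfolding E_def u_def hstar_def hhat_def by (simp add: case_prod_beta')
  have M: "(\<integral>(w, v). (inner_p p (fstar w) (gstar v))\<^sup>2 \<partial>(W \<Otimes>\<^sub>M V)) \<le> Mstar\<^sup>2"
    if "W \<in> {DW1, DW2}" "V \<in> {DV1, DV2}" for W V
    using Mbound[OF that] unfolding hstar_def by (simp add: case_prod_beta')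
  define B where "B = 64 * Mstar ^ 4 / sigstar2\<^sup>2"
  have "E DW2 DV2 \<le> 27 * (Mstar\<^sup>2 / (s * t))\<^sup>2 * (E DW1 DV1 + E DW1 DV2 + E DW2 DV1)"
    using completion_error_bound[of DW1 DW2 DV1 DV2 p fstar fhat gstar ghat s t "Mstar\<^sup>2",
        OF prob_W prob_V f g s0 s(2) t0 t(2) p M]
      small' E0[of DW1 DV1] E0[of DW1 DV2] E0[of DW2 DV1] unfolding EE by simp
  \<comment> \<open>The constant 27 is relaxed to 64.\<close>
  also have "\<dots> \<le> B * (E DW1 DV1 + E DW1 DV2 + E DW2 DV1)"
    using E0 s0 t0 unfolding B_def sig
    by (intro mult_right_mono) (auto simp: power_divide divide_right_mono)
  finally have "E DW1 DV1 + E DW1 DV2 + E DW2 DV1 + E DW2 DV2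
      \<le> (1 + B) * (E DW1 DV1 + E DW1 DV2 + E DW2 DV1)" by (simp add: algebra_simps)
  also have "\<dots> \<le> (1 + B) * (\<kappa> * risk hstar hhat D)"
    using lowerE unfolding B_def by (intro mult_left_mono) auto
  finally have "\<kappa> * (E DW1 DV1 + E DW1 DV2 + E DW2 DV1 + E DW2 DV2) \<le> \<kappa> * ((1 + B) * (\<kappa> * risk hstar hhat D))"
    using \<kappa> by (rule mult_left_mono)
  thus ?thesis using upperE unfolding B_def by (simp add: power2_eq_square mult_ac)
qed

end
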